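(* Let $(F,G,\triangleright,\triangleleft)$ be a matched pair of finite groups and $\Bbbk$ a field. Then the bismash product Hopf algebra $\Bbbk^G\#\Bbbk F$ is the left partially dualized Hopf algebra of $\Bbbk(F\bowtie G)$ determined by the admissible mapping system $(\pi_F,\iota_G^* )$ for $\iota_F:\Bbbk F\rightarrowtail\Bbbk(F\bowtie G)$.
   Context: Matched pair. Groups $F,G$ with a left action $\triangleright:G\times F\to F$ of $G$ on the set $F$ and a right action $\triangleleft:G\times F\to G$ of $F$ on the set $G$ such that $x\triangleright bc=(x\triangleright b)((x\triangleleft b)\triangleright c)$ and $xy\triangleleft b=(x\triangleleft(y\triangleright b))(y\triangleleft b)$ for $b,c\in F$, $x,y\in G$. $F\bowtie G$ is the group $F\times G$ with product $(b,x)(c,y)=(b(x\triangleright c),(x\triangleleft c)y)$. $\Bbbk^G=(\Bbbk G)^*$ with basis $\{p_x\}_{x\in G}$ dual to $G$. Bismash product. $\Bbbk^G\#\Bbbk F$ is the Hopf algebra with basis $p_x\#b$ ($x\in G,b\in F$), product $(p_x\#b)(p_y\#c)=\delta_{x\triangleleft b,y}\,p_x\#bc$, unit $\sum_xp_x\#1$, coproduct $\Delta(p_x\#b)=\sum_{y\in G}(p_{xy^{-1}}\#(y\triangleright b))\otimes(p_y\#b)$, counit $\varepsilon(p_x\#b)=\delta_{x,1}$. Partially admissible mapping system. Let $H$ be a finite-dimensional Hopf algebra, $\iota:B\rightarrowtail H$ an injective map of left $H$-comodule algebras, $\pi:H\twoheadrightarrow C$ a surjective map of right $H$-module coalgebras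 (action $\blacktriangleleft$ on $C$), with $\iota(B)=\{h\in H:\sum h_{(1)}\otimes\pi(h_{(2)})=h\otimes\pi(1)\}$. A partially admissible mapping system $(\zeta,\gamma^* )$ for $\iota$ consists of linear maps $\zeta:H\to B$, $\gamma:C\to H$ (with transposes $\zeta^*:B^*\to H^*$, $\gamma^*:H^*\to C^*$) such that: $\zeta,\gamma$ are convolution invertible; $\zeta(\iota(b)h)=b\,\zeta(h)$ and $\sum\gamma(x)_{(1)}\otimes\pi(\gamma(x)_{(2)})=\sum\gamma(x_{(1)})\otimes x_{(2)}$; $\zeta(1)=1$, $\varepsilon\circ\iota\circ\zeta=\varepsilon$, $\gamma(\pi(1))=1$, $\varepsilon\circ\gamma=\varepsilon_C$; and $\sum\iota(\zeta(h_{(1)}))\gamma(\pi(h_{(2)}))=h$. Left partial dual. Write $\sum b_{(1)}\otimes b_{(2)}\in H\otimes B$ for the coaction on $b\in B$, and $\sum f_{(1)}\otimes f_{(2)}\in C^*\otimes H^*$ for $f\in C^*$, determined by $\langle f,x\blacktriangleleft h\rangle=\sum\langle f_{(1)},x\rangle\langle f_{(2)},h\rangle$. The left partial dual of $H$ determined by $(\zeta,\gamma^* )$ is the quasi-Hopf algebra $C^*\#B=C^*\otimes B$ with unit $\varepsilon\#1$, product $(f\#b)(g\#c)=\sum fg_{(1)}\#\langle g_{(2)},b_{(1)}\rangle b_{(2)}c$, comultiplication $\mathbf\Delta(f\#b)=\sum_{i,j}(f_{(1)}\#b_i\zeta[\gamma(f_j^* )b_{(1)}])\otimes(\gamma^*[f_{(2)}\zeta^*(b_i^*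 )]f_j\#b_{(2)})$, counit $f\#b\mapsto\langle f,\pi(1)\rangle\langle\varepsilon,\iota(b)\rangle$, and associator with inverse $\sum_{i,j}(\varepsilon\#b_i)\otimes(\gamma^*[\zeta^*(b_i^* )_{(1)}]\#b_j)\otimes(\gamma^*[\zeta^*(b_i^* )_{(2)}\zeta^*(b_j^* )]\#1)$; here $\{b_i\},\{b_i^*\}$ are dual bases of $B,B^*$ and $\{f_j\},\{f_j^*\}$ dual bases of $C^*,C$. The system is admissible, and the left partial dual is called a left partially dualized Hopf algebra, if the associator is $(\varepsilon\#1)^{\otimes3}$. The system in the claim. $H=\Bbbk(F\bowtie G)$, $B=\Bbbk F$, $C=\Bbbk G$ with right $H$-action $x\otimes(b,y)\mapsto(x\triangleleft b)y$; the linear maps are determined by $\iota=\iota_F:b\mapsto(b,1)$, $\zeta=\pi_F:(b,x)\mapsto b$, $\pi=\pi_G:(b,x)\mapsto x$, $\gamma=\iota_G:x\mapsto(1,x)$. This is an admissible mapping system for $\iota_F$. *)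

theory Defs
  imports "HOL-Algebra.Group" "HOL-Library.Function_Algebras"
begin

section \<open>Coordinate vector spaces and tensors\<close>

text \<open>
  A finite-dimensional vector space is given by a finite basis \<open>I\<close> and consists of the coordinate
  vectors supported on \<open>I\<close>.  The tensor product of the spaces with bases \<open>I\<close> and \<open>J\<close> has basis
  \<open>I \<times> J\<close>.  The dual space is represented on the same index set, in the dual basis: \<open>f i\<close> is the
  value of the functional \<open>f\<close> at the basis vector with index \<open>i\<close>.
\<close>

definition vspace :: "'a set \<Rightarrow> ('a \<Rightarrow> 'k::field) set" where
  "vspace I = {v. \<forall>i. i \<notin> I \<longrightarrow> v i = 0}"

definition bvec :: "'a \<Rightarrow> 'a \<Rightarrow> 'k::field" where
  "bvec i = (\<lambda>j. if j = i then 1 else 0)"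

definition scal :: "'k::field \<Rightarrow> ('a \<Rightarrow> 'k) \<Rightarrow> 'a \<Rightarrow> 'k"  (infixr "\<cdot>" 72) where
  "c \<cdot> v = (\<lambda>i. c * v i)"

definition tensor :: "('a \<Rightarrow> 'k::field) \<Rightarrow> ('b \<Rightarrow> 'k) \<Rightarrow> 'a \<times> 'b \<Rightarrow> 'k"  (infixr "\<otimes>\<^sub>k" 71) where
  "v \<otimes>\<^sub>k w = (\<lambda>(i, j). v i * w j)"

definition klinear :: "'a set \<Rightarrow> 'b set \<Rightarrow> (('a \<Rightarrow> 'k::field) \<Rightarrow> 'b \<Rightarrow> 'k) \<Rightarrow> bool" where
  "klinear I J T \<longleftrightarrow>
     (\<forall>v\<in>vspace I. T v \<in> vspace J) \<and>
     (\<forall>v\<in>vspace I. \<forall>w\<in>vspace I. T (v + w) = T v + T w) \<and>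
     (\<forall>c. \<forall>v\<in>vspace I. T (c \<cdot> v) = c \<cdot> T v)"

definition kfunctional :: "'a set \<Rightarrow> (('a \<Rightarrow> 'k::field) \<Rightarrow> 'k) \<Rightarrow> bool" where
  "kfunctional I e \<longleftrightarrow>
     (\<forall>v\<in>vspace I. \<forall>w\<in>vspace I. e (v + w) = e v + e w) \<and>
     (\<forall>c. \<forall>v\<in>vspace I. e (c \<cdot> v) = c * e v)"

definition kbilinear ::
  "'a set \<Rightarrow> 'b set \<Rightarrow> 'c set \<Rightarrow> (('a \<Rightarrow> 'k::field) \<Rightarrow> ('b \<Rightarrow> 'k) \<Rightarrow> 'c \<Rightarrow> 'k) \<Rightarrow> bool" where
  "kbilinear I J L m \<longleftrightarrow>
     (\<forall>v\<in>vspace I. klinear J L (m v)) \<and> (\<forall>w\<in>vspace J. klinear I L (\<lambda>v. m v w))"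

text \<open>Linear and bilinear maps determined by their values on basis vectors.\<close>

definition linext :: "'a set \<Rightarrow> ('a \<Rightarrow> 'b \<Rightarrow> 'k::field) \<Rightarrow> ('a \<Rightarrow> 'k) \<Rightarrow> 'b \<Rightarrow> 'k" where
  "linext I \<phi> v = (\<Sum>i\<in>I. v i \<cdot> \<phi> i)"

definition bilext ::
  "'a set \<Rightarrow> 'b set \<Rightarrow> ('a \<Rightarrow> 'b \<Rightarrow> 'c \<Rightarrow> 'k::field) \<Rightarrow> ('a \<Rightarrow> 'k) \<Rightarrow> ('b \<Rightarrow> 'k) \<Rightarrow> 'c \<Rightarrow> 'k" where
  "bilext I J \<phi> v w = (\<Sum>i\<in>I. \<Sum>j\<in>J. (v i * w j) \<cdot> \<phi> i j)"

text \<open>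
  The value at the tensor \<open>t\<close> of the linear map on the tensor product induced by the bilinear
  map \<open>m\<close>.  This renders Sweedler notation: \<open>sweedler I I (\<Delta> h) m\<close> is
  \<open>\<Sum> m h\<^sub>1 h\<^sub>2\<close>.
\<close>

definition sweedler ::
  "'a set \<Rightarrow> 'b set \<Rightarrow> ('a \<times> 'b \<Rightarrow> 'k::field) \<Rightarrow>
   (('a \<Rightarrow> 'k) \<Rightarrow> ('b \<Rightarrow> 'k) \<Rightarrow> 'c \<Rightarrow> 'k) \<Rightarrow> 'c \<Rightarrow> 'k" where
  "sweedler I J t m = (\<Sum>i\<in>I. \<Sum>j\<in>J. t (i, j) \<cdot> m (bvec i) (bvec j))"

definition pairing :: "'a set \<Rightarrow> ('a \<Rightarrow> 'k::field) \<Rightarrow> ('a \<Rightarrow> 'k) \<Rightarrow> 'k" where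
  "pairing I f v = (\<Sum>i\<in>I. f i * v i)"

definition transposed ::
  "'a set \<Rightarrow> 'b set \<Rightarrow> (('a \<Rightarrow> 'k::field) \<Rightarrow> 'b \<Rightarrow> 'k) \<Rightarrow> ('b \<Rightarrow> 'k) \<Rightarrow> 'a \<Rightarrow> 'k" where
  "transposed I J T f = (\<lambda>i. if i \<in> I then pairing J f (T (bvec i)) else 0)"


section \<open>Algebras, coalgebras, Hopf algebras\<close>

record ('a, 'k) alg =
  abasis :: "'a set"
  amult :: "('a \<Rightarrow> 'k) \<Rightarrow> ('a \<Rightarrow> 'k) \<Rightarrow> 'a \<Rightarrow> 'k"
  aone :: "'a \<Rightarrow> 'k"

record ('a, 'k) coalg =
  cbasis :: "'a set"
  ccomult :: "('a \<Rightarrow> 'k) \<Rightarrow> 'a \<times> 'a \<Rightarrow> 'k"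
  ccounit :: "('a \<Rightarrow> 'k) \<Rightarrow> 'k"

record ('a, 'k) bialg = "('a, 'k) alg" +
  bcomult :: "('a \<Rightarrow> 'k) \<Rightarrow> 'a \<times> 'a \<Rightarrow> 'k"
  bcounit :: "('a \<Rightarrow> 'k) \<Rightarrow> 'k"

record ('h, 'b, 'k) comod_alg = "('b, 'k) alg" +
  coact :: "('b \<Rightarrow> 'k) \<Rightarrow> 'h \<times> 'b \<Rightarrow> 'k"

record ('h, 'c, 'k) mod_coalg = "('c, 'k) coalg" +
  act :: "('c \<Rightarrow> 'k) \<Rightarrow> ('h \<Rightarrow> 'k) \<Rightarrow> 'c \<Rightarrow> 'k"

text \<open>The data of a quasi-bialgebra; the associator is recorded through its inverse.\<close>

record ('a, 'k) quasi_bialg = "('a, 'k) bialg" +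
  inv_assoc :: "'a \<times> 'a \<times> 'a \<Rightarrow> 'k"

definition coalg_of :: "('a, 'k, 'm) bialg_scheme \<Rightarrow> ('a, 'k) coalg" where
  "coalg_of H = \<lparr>cbasis = abasis H, ccomult = bcomult H, ccounit = bcounit H\<rparr>"

definition tensor_alg ::
  "('a, 'k::field, 'm) alg_scheme \<Rightarrow> ('b, 'k, 'n) alg_scheme \<Rightarrow> ('a \<times> 'b, 'k) alg" where
  "tensor_alg A B = \<lparr>
     abasis = abasis A \<times> abasis B,
     amult = (\<lambda>s t. sweedler (abasis A) (abasis B) s (\<lambda>a b.
                    sweedler (abasis A) (abasis B) t (\<lambda>a' b'.
                      amult A a a' \<otimes>\<^sub>k amult B b b'))),
     aone = aone A \<otimes>\<^sub>k aone B\<rparr>"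

definition k_algebra :: "('a, 'k::field, 'm) alg_scheme \<Rightarrow> bool" where
  "k_algebra A \<longleftrightarrow> finite (abasis A) \<and>
     kbilinear (abasis A) (abasis A) (abasis A) (amult A) \<and>
     aone A \<in> vspace (abasis A) \<and>
     (\<forall>a\<in>vspace (abasis A). amult A (aone A) a = a \<and> amult A a (aone A) = a) \<and>
     (\<forall>a\<in>vspace (abasis A). \<forall>b\<in>vspace (abasis A). \<forall>c\<in>vspace (abasis A).
        amult A (amult A a b) c = amult A a (amult A b c))"

definition algebra_map ::
  "('a, 'k::field, 'm) alg_scheme \<Rightarrow> ('b, 'k, 'n) alg_scheme \<Rightarrow>
   (('a \<Rightarrow> 'k) \<Rightarrow> 'b \<Rightarrow> 'k) \<Rightarrow> bool" where
  "algebra_map A B T \<longleftrightarrow> klinear (abasis A) (abasis B) T \<and> T (aone A) = aone B \<and>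
     (\<forall>a\<in>vspace (abasis A). \<forall>b\<in>vspace (abasis A). T (amult A a b) = amult B (T a) (T b))"

definition k_coalgebra :: "('c, 'k::field, 'm) coalg_scheme \<Rightarrow> bool" where
  "k_coalgebra C \<longleftrightarrow> (let I = cbasis C; \<Delta> = ccomult C; \<epsilon> = ccounit C in
     finite I \<and> klinear I (I \<times> I) \<Delta> \<and> kfunctional I \<epsilon> \<and>
     (\<forall>x\<in>vspace I.
        sweedler I I (\<Delta> x) (\<lambda>x1 x2. \<epsilon> x1 \<cdot> x2) = x \<and>
        sweedler I I (\<Delta> x) (\<lambda>x1 x2. \<epsilon> x2 \<cdot> x1) = x \<and>
        sweedler I I (\<Delta> x) (\<lambda>y z. sweedler I I (\<Delta> y) (\<lambda>y1 y2. y1 \<otimes>\<^sub>k y2 \<otimes>\<^sub>k z)) =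
        sweedler I I (\<Delta> x) (\<lambda>y z. sweedler I I (\<Delta> z) (\<lambda>z1 z2. y \<otimes>\<^sub>k z1 \<otimes>\<^sub>k z2))))"

definition coalgebra_map ::
  "('c, 'k::field, 'm) coalg_scheme \<Rightarrow> ('d, 'k, 'n) coalg_scheme \<Rightarrow>
   (('c \<Rightarrow> 'k) \<Rightarrow> 'd \<Rightarrow> 'k) \<Rightarrow> bool" where
  "coalgebra_map C D T \<longleftrightarrow> klinear (cbasis C) (cbasis D) T \<and>
     (\<forall>x\<in>vspace (cbasis C).
        ccounit D (T x) = ccounit C x \<and>
        ccomult D (T x) =
          sweedler (cbasis C) (cbasis C) (ccomult C x) (\<lambda>x1 x2. T x1 \<otimes>\<^sub>k T x2))"

definition k_bialgebra :: "('a, 'k::field, 'm) bialg_scheme \<Rightarrow> bool" where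
  "k_bialgebra H \<longleftrightarrow> k_algebra H \<and> k_coalgebra (coalg_of H) \<and>
     algebra_map H (tensor_alg H H) (bcomult H) \<and>
     bcounit H (aone H) = 1 \<and>
     (\<forall>a\<in>vspace (abasis H). \<forall>b\<in>vspace (abasis H).
        bcounit H (amult H a b) = bcounit H a * bcounit H b)"

definition conv_inverse ::
  "('c, 'k::field, 'm) coalg_scheme \<Rightarrow> ('a, 'k, 'n) alg_scheme \<Rightarrow>
   (('c \<Rightarrow> 'k) \<Rightarrow> 'a \<Rightarrow> 'k) \<Rightarrow> (('c \<Rightarrow> 'k) \<Rightarrow> 'a \<Rightarrow> 'k) \<Rightarrow> bool" where
  "conv_inverse C A S T \<longleftrightarrow> klinear (cbasis C) (abasis A) S \<and> klinear (cbasis C) (abasis A) T \<and>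
     (\<forall>x\<in>vspace (cbasis C).
        sweedler (cbasis C) (cbasis C) (ccomult C x) (\<lambda>x1 x2. amult A (S x1) (T x2))
          = ccounit C x \<cdot> aone A \<and>
        sweedler (cbasis C) (cbasis C) (ccomult C x) (\<lambda>x1 x2. amult A (T x1) (S x2))
          = ccounit C x \<cdot> aone A)"

definition conv_invertible ::
  "('c, 'k::field, 'm) coalg_scheme \<Rightarrow> ('a, 'k, 'n) alg_scheme \<Rightarrow>
   (('c \<Rightarrow> 'k) \<Rightarrow> 'a \<Rightarrow> 'k) \<Rightarrow> bool" where
  "conv_invertible C A T \<longleftrightarrow> (\<exists>S. conv_inverse C A S T)"

text \<open>An antipode is a convolution inverse of the identity.\<close>

definition hopf_algebra :: "('a, 'k::field, 'm) bialg_scheme \<Rightarrow> bool" where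
  "hopf_algebra H \<longleftrightarrow> k_bialgebra H \<and> (\<exists>S. conv_inverse (coalg_of H) H S (\<lambda>h. h))"

text \<open>Isomorphisms of bialgebras; between Hopf algebras they automatically respect antipodes.\<close>

definition bialgebra_iso ::
  "('a, 'k::field, 'm) bialg_scheme \<Rightarrow> ('b, 'k, 'n) bialg_scheme \<Rightarrow>
   (('a \<Rightarrow> 'k) \<Rightarrow> 'b \<Rightarrow> 'k) \<Rightarrow> bool" where
  "bialgebra_iso A B T \<longleftrightarrow> bij_betw T (vspace (abasis A)) (vspace (abasis B)) \<and>
     algebra_map A B T \<and> coalgebra_map (coalg_of A) (coalg_of B) T"

text \<open>The dual algebra of a coalgebra, in the dual basis, with \<open>\<langle>f g, x\<rangle> = \<Sum> \<langle>f, x\<^sub>1\<rangle> \<langle>g, x\<^sub>2\<rangle>\<close>.\<close>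

definition dual_alg :: "('c, 'k::field, 'm) coalg_scheme \<Rightarrow> ('c, 'k) alg" where
  "dual_alg C = \<lparr>
     abasis = cbasis C,
     amult = (\<lambda>f g i. if i \<in> cbasis C
        then pairing (cbasis C \<times> cbasis C) (f \<otimes>\<^sub>k g) (ccomult C (bvec i)) else 0),
     aone = (\<lambda>i. if i \<in> cbasis C then ccounit C (bvec i) else 0)\<rparr>"

text \<open>\<open>\<langle>f, h k\<rangle> = \<Sum> \<langle>f\<^sub>1, h\<rangle> \<langle>f\<^sub>2, k\<rangle>\<close>\<close>

definition dual_comult :: "('a, 'k::field, 'm) alg_scheme \<Rightarrow> ('a \<Rightarrow> 'k) \<Rightarrow> 'a \<times> 'a \<Rightarrow> 'k" where
  "dual_comult A f = (\<lambda>(i, j). if i \<in> abasis A \<and> j \<in> abasis A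
     then pairing (abasis A) f (amult A (bvec i) (bvec j)) else 0)"


section \<open>Partially admissible mapping systems\<close>

definition left_comodule_algebra ::
  "('h, 'k::field, 'm) bialg_scheme \<Rightarrow> ('h, 'b, 'k, 'n) comod_alg_scheme \<Rightarrow> bool" where
  "left_comodule_algebra H B \<longleftrightarrow> (let I = abasis H; J = abasis B; \<rho> = coact B in
     k_algebra B \<and> algebra_map B (tensor_alg H B) \<rho> \<and>
     (\<forall>b\<in>vspace J.
        sweedler I J (\<rho> b) (\<lambda>b1 b2. bcounit H b1 \<cdot> b2) = b \<and>
        sweedler I J (\<rho> b) (\<lambda>h c. sweedler I I (bcomult H h) (\<lambda>h1 h2. h1 \<otimes>\<^sub>k h2 \<otimes>\<^sub>k c)) =
        sweedler I J (\<rho> b) (\<lambda>h c. sweedler I J (\<rho> c) (\<lambda>c1 c2. h \<otimes>\<^sub>k c1 \<otimes>\<^sub>k c2))))"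

definition right_module_coalgebra ::
  "('h, 'k::field, 'm) bialg_scheme \<Rightarrow> ('h, 'c, 'k, 'n) mod_coalg_scheme \<Rightarrow> bool" where
  "right_module_coalgebra H C \<longleftrightarrow> (let I = abasis H; L = cbasis C in
     k_coalgebra C \<and> kbilinear L I L (act C) \<and>
     (\<forall>x\<in>vspace L. act C x (aone H) = x) \<and>
     (\<forall>x\<in>vspace L. \<forall>h\<in>vspace I. \<forall>h'\<in>vspace I.
        act C x (amult H h h') = act C (act C x h) h') \<and>
     (\<forall>x\<in>vspace L. \<forall>h\<in>vspace I.
        ccounit C (act C x h) = ccounit C x * bcounit H h \<and>
        ccomult C (act C x h) =
          sweedler L L (ccomult C x) (\<lambda>x1 x2.
          sweedler I I (bcomult H h) (\<lambda>h1 h2. act C x1 h1 \<otimes>\<^sub>k act C x2 h2))))"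

definition comodule_algebra_map_into ::
  "('h, 'k::field, 'm) bialg_scheme \<Rightarrow> ('h, 'b, 'k, 'n) comod_alg_scheme \<Rightarrow>
   (('b \<Rightarrow> 'k) \<Rightarrow> 'h \<Rightarrow> 'k) \<Rightarrow> bool" where
  "comodule_algebra_map_into H B \<iota> \<longleftrightarrow> algebra_map B H \<iota> \<and>
     (\<forall>b\<in>vspace (abasis B).
        bcomult H (\<iota> b) = sweedler (abasis H) (abasis B) (coact B b) (\<lambda>b1 b2. b1 \<otimes>\<^sub>k \<iota> b2))"

definition module_coalgebra_map_from ::
  "('h, 'k::field, 'm) bialg_scheme \<Rightarrow> ('h, 'c, 'k, 'n) mod_coalg_scheme \<Rightarrow>
   (('h \<Rightarrow> 'k) \<Rightarrow> 'c \<Rightarrow> 'k) \<Rightarrow> bool" where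
  "module_coalgebra_map_from H C \<pi> \<longleftrightarrow> coalgebra_map (coalg_of H) C \<pi> \<and>
     (\<forall>h\<in>vspace (abasis H). \<forall>h'\<in>vspace (abasis H). \<pi> (amult H h h') = act C (\<pi> h) h')"

definition partially_admissible_system ::
  "('h, 'k::field, 'm) bialg_scheme \<Rightarrow> ('h, 'b, 'k, 'n) comod_alg_scheme \<Rightarrow>
   ('h, 'c, 'k, 'p) mod_coalg_scheme \<Rightarrow>
   (('b \<Rightarrow> 'k) \<Rightarrow> 'h \<Rightarrow> 'k) \<Rightarrow> (('h \<Rightarrow> 'k) \<Rightarrow> 'c \<Rightarrow> 'k) \<Rightarrow>
   (('h \<Rightarrow> 'k) \<Rightarrow> 'b \<Rightarrow> 'k) \<Rightarrow> (('c \<Rightarrow> 'k) \<Rightarrow> 'h \<Rightarrow> 'k) \<Rightarrow> bool" where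
  "partially_admissible_system H B C \<iota> \<pi> \<zeta> \<gamma> \<longleftrightarrow>
     (let I = abasis H; J = abasis B; L = cbasis C; \<Delta> = bcomult H in
      hopf_algebra H \<and>
      left_comodule_algebra H B \<and> comodule_algebra_map_into H B \<iota> \<and> inj_on \<iota> (vspace J) \<and>
      right_module_coalgebra H C \<and> module_coalgebra_map_from H C \<pi> \<and>
      \<pi> ` vspace I = vspace L \<and>
      \<iota> ` vspace J =
        {h \<in> vspace I. sweedler I I (\<Delta> h) (\<lambda>h1 h2. h1 \<otimes>\<^sub>k \<pi> h2) = h \<otimes>\<^sub>k \<pi> (aone H)} \<and>
      klinear I J \<zeta> \<and> klinear L I \<gamma> \<and>
      conv_invertible (coalg_of H) B \<zeta> \<and> conv_invertible C H \<gamma> \<and>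
      (\<forall>b\<in>vspace J. \<forall>h\<in>vspace I. \<zeta> (amult H (\<iota> b) h) = amult B b (\<zeta> h)) \<and>
      (\<forall>x\<in>vspace L. sweedler I I (\<Delta> (\<gamma> x)) (\<lambda>y1 y2. y1 \<otimes>\<^sub>k \<pi> y2) =
                     sweedler L L (ccomult C x) (\<lambda>x1 x2. \<gamma> x1 \<otimes>\<^sub>k x2)) \<and>
      \<zeta> (aone H) = aone B \<and>
      (\<forall>h\<in>vspace I. bcounit H (\<iota> (\<zeta> h)) = bcounit H h) \<and>
      \<gamma> (\<pi> (aone H)) = aone H \<and>
      (\<forall>x\<in>vspace L. bcounit H (\<gamma> x) = ccounit C x) \<and>
      (\<forall>h\<in>vspace I. sweedler I I (\<Delta> h) (\<lambda>h1 h2. amult H (\<iota> (\<zeta> h1)) (\<gamma> (\<pi> h2))) = h))"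


section \<open>Left partial duals\<close>

text \<open>The coaction on the dual of \<open>C\<close>: \<open>\<langle>f, act C x h\<rangle> = \<Sum> \<langle>f\<^sub>1, x\<rangle> \<langle>f\<^sub>2, h\<rangle>\<close>.\<close>

definition dual_coact ::
  "('h, 'k::field, 'm) bialg_scheme \<Rightarrow> ('h, 'c, 'k, 'n) mod_coalg_scheme \<Rightarrow>
   ('c \<Rightarrow> 'k) \<Rightarrow> 'c \<times> 'h \<Rightarrow> 'k" where
  "dual_coact H C f = (\<lambda>(i, j). if i \<in> cbasis C \<and> j \<in> abasis H
     then pairing (cbasis C) f (act C (bvec i) (bvec j)) else 0)"

text \<open>
  The operations are the linear extensions of the formulas on pure tensors \<open>f \<otimes>\<^sub>k b\<close>.
  Since dual spaces are written in dual bases, \<open>bvec i\<close> plays the role of a basis vector as well as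
  of the corresponding vector of the dual basis.
\<close>

definition left_partial_dual ::
  "('h, 'k::field, 'm) bialg_scheme \<Rightarrow> ('h, 'b, 'k, 'n) comod_alg_scheme \<Rightarrow>
   ('h, 'c, 'k, 'p) mod_coalg_scheme \<Rightarrow>
   (('b \<Rightarrow> 'k) \<Rightarrow> 'h \<Rightarrow> 'k) \<Rightarrow> (('h \<Rightarrow> 'k) \<Rightarrow> 'c \<Rightarrow> 'k) \<Rightarrow>
   (('h \<Rightarrow> 'k) \<Rightarrow> 'b \<Rightarrow> 'k) \<Rightarrow> (('c \<Rightarrow> 'k) \<Rightarrow> 'h \<Rightarrow> 'k) \<Rightarrow>
   ('c \<times> 'b, 'k) quasi_bialg" where
  "left_partial_dual H B C \<iota> \<pi> \<zeta> \<gamma> =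
     (let I = abasis H; J = abasis B; L = cbasis C;
          mulC = amult (dual_alg C); oneC = aone (dual_alg C);
          mulH = amult (dual_alg (coalg_of H));
          \<zeta>t = transposed I J \<zeta>; \<gamma>t = transposed L I \<gamma>
      in \<lparr>
        abasis = L \<times> J,
        amult = (\<lambda>s t.
          sweedler L J s (\<lambda>f b. sweedler L J t (\<lambda>g c.
          sweedler L I (dual_coact H C g) (\<lambda>g1 g2. sweedler I J (coact B b) (\<lambda>b1 b2.
            mulC f g1 \<otimes>\<^sub>k (pairing I g2 b1 \<cdot> amult B b2 c)))))),
        aone = oneC \<otimes>\<^sub>k aone B,
        bcomult = (\<lambda>s.
          sweedler L J s (\<lambda>f b.
          sweedler L I (dual_coact H C f) (\<lambda>f1 f2. sweedler I J (coact B b) (\<lambda>b1 b2.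
            \<Sum>i\<in>J. \<Sum>j\<in>L.
              (f1 \<otimes>\<^sub>k amult B (bvec i) (\<zeta> (amult H (\<gamma> (bvec j)) b1))) \<otimes>\<^sub>k
              (mulC (\<gamma>t (mulH f2 (\<zeta>t (bvec i)))) (bvec j) \<otimes>\<^sub>k b2))))),
        bcounit = (\<lambda>s. \<Sum>(i, j)\<in>L \<times> J.
          s (i, j) * (pairing L (bvec i) (\<pi> (aone H)) * bcounit H (\<iota> (bvec j)))),
        inv_assoc =
          (\<Sum>i\<in>J. \<Sum>j\<in>J. sweedler I I (dual_comult H (\<zeta>t (bvec i))) (\<lambda>u1 u2.
             (oneC \<otimes>\<^sub>k bvec i) \<otimes>\<^sub>k
             (\<gamma>t u1 \<otimes>\<^sub>k bvec j) \<otimes>\<^sub>k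
             (\<gamma>t (mulH u2 (\<zeta>t (bvec j))) \<otimes>\<^sub>k aone B)))\<rparr>)"

text \<open>The associator is the inverse of \<open>inv_assoc\<close> in the third tensor power.\<close>

definition is_associator ::
  "('a, 'k::field, 'm) quasi_bialg_scheme \<Rightarrow> ('a \<times> 'a \<times> 'a \<Rightarrow> 'k) \<Rightarrow> bool" where
  "is_associator D \<phi> \<longleftrightarrow> (let D3 = tensor_alg D (tensor_alg D D) in
     \<phi> \<in> vspace (abasis D3) \<and> inv_assoc D \<in> vspace (abasis D3) \<and>
     amult D3 \<phi> (inv_assoc D) = aone D3 \<and> amult D3 (inv_assoc D) \<phi> = aone D3)"

definition admissible_system ::
  "('h, 'k::field, 'm) bialg_scheme \<Rightarrow> ('h, 'b, 'k, 'n) comod_alg_scheme \<Rightarrow>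
   ('h, 'c, 'k, 'p) mod_coalg_scheme \<Rightarrow>
   (('b \<Rightarrow> 'k) \<Rightarrow> 'h \<Rightarrow> 'k) \<Rightarrow> (('h \<Rightarrow> 'k) \<Rightarrow> 'c \<Rightarrow> 'k) \<Rightarrow>
   (('h \<Rightarrow> 'k) \<Rightarrow> 'b \<Rightarrow> 'k) \<Rightarrow> (('c \<Rightarrow> 'k) \<Rightarrow> 'h \<Rightarrow> 'k) \<Rightarrow> bool" where
  "admissible_system H B C \<iota> \<pi> \<zeta> \<gamma> \<longleftrightarrow>
     partially_admissible_system H B C \<iota> \<pi> \<zeta> \<gamma> \<and>
     (let D = left_partial_dual H B C \<iota> \<pi> \<zeta> \<gamma> in
      is_associator D (aone D \<otimes>\<^sub>k aone D \<otimes>\<^sub>k aone D))"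


section \<open>Matched pairs and bismash products\<close>

locale matched_pair = F: group F + G: group G
  for F :: "('f, 'm) monoid_scheme" and G :: "('g, 'n) monoid_scheme" +
  fixes lact :: "'g \<Rightarrow> 'f \<Rightarrow> 'f"  (infixr "\<rhd>" 75)
    and ract :: "'g \<Rightarrow> 'f \<Rightarrow> 'g"  (infixl "\<lhd>" 75)
  assumes lact_closed: "\<lbrakk>x \<in> carrier G; b \<in> carrier F\<rbrakk> \<Longrightarrow> x \<rhd> b \<in> carrier F"
    and lact_one: "b \<in> carrier F \<Longrightarrow> \<one>\<^bsub>G\<^esub> \<rhd> b = b"
    and lact_mult: "\<lbrakk>x \<in> carrier G; y \<in> carrier G; b \<in> carrier F\<rbrakk> \<Longrightarrow>
      (x \<otimes>\<^bsub>G\<^esub> y) \<rhd> b = x \<rhd> (y \<rhd> b)"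
    and ract_closed: "\<lbrakk>x \<in> carrier G; b \<in> carrier F\<rbrakk> \<Longrightarrow> x \<lhd> b \<in> carrier G"
    and ract_one: "x \<in> carrier G \<Longrightarrow> x \<lhd> \<one>\<^bsub>F\<^esub> = x"
    and ract_mult: "\<lbrakk>x \<in> carrier G; b \<in> carrier F; c \<in> carrier F\<rbrakk> \<Longrightarrow>
      x \<lhd> (b \<otimes>\<^bsub>F\<^esub> c) = (x \<lhd> b) \<lhd> c"
    and lact_match: "\<lbrakk>x \<in> carrier G; b \<in> carrier F; c \<in> carrier F\<rbrakk> \<Longrightarrow>
      x \<rhd> (b \<otimes>\<^bsub>F\<^esub> c) = (x \<rhd> b) \<otimes>\<^bsub>F\<^esub> ((x \<lhd> b) \<rhd> c)"
    and ract_match: "\<lbrakk>x \<in> carrier G; y \<in> carrier G; b \<in> carrier F\<rbrakk> \<Longrightarrow>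
      (x \<otimes>\<^bsub>G\<^esub> y) \<lhd> b = (x \<lhd> (y \<rhd> b)) \<otimes>\<^bsub>G\<^esub> (y \<lhd> b)"

definition bowtie ::
  "('f, 'm) monoid_scheme \<Rightarrow> ('g, 'n) monoid_scheme \<Rightarrow> ('g \<Rightarrow> 'f \<Rightarrow> 'f) \<Rightarrow> ('g \<Rightarrow> 'f \<Rightarrow> 'g) \<Rightarrow>
   ('f \<times> 'g) monoid" where
  "bowtie F G lact ract = \<lparr>
     carrier = carrier F \<times> carrier G,
     mult = (\<lambda>(b, x) (c, y). (b \<otimes>\<^bsub>F\<^esub> lact x c, ract x c \<otimes>\<^bsub>G\<^esub> y)),
     one = (\<one>\<^bsub>F\<^esub>, \<one>\<^bsub>G\<^esub>)\<rparr>"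

definition group_bialg :: "('a, 'm) monoid_scheme \<Rightarrow> ('a, 'k::field) bialg" where
  "group_bialg K = \<lparr>
     abasis = carrier K,
     amult = bilext (carrier K) (carrier K) (\<lambda>g h. bvec (g \<otimes>\<^bsub>K\<^esub> h)),
     aone = bvec \<one>\<^bsub>K\<^esub>,
     bcomult = linext (carrier K) (\<lambda>g. bvec g \<otimes>\<^sub>k bvec g),
     bcounit = (\<lambda>v. \<Sum>g\<in>carrier K. v g)\<rparr>"

text \<open>The index \<open>(x, b)\<close> stands for the basis vector \<open>p\<^sub>x # b\<close>.\<close>

definition bismash ::
  "('f, 'm) monoid_scheme \<Rightarrow> ('g, 'n) monoid_scheme \<Rightarrow> ('g \<Rightarrow> 'f \<Rightarrow> 'f) \<Rightarrow> ('g \<Rightarrow> 'f \<Rightarrow> 'g) \<Rightarrow>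
   ('g \<times> 'f, 'k::field) bialg" where
  "bismash F G lact ract = (let X = carrier G \<times> carrier F in \<lparr>
     abasis = X,
     amult = bilext X X (\<lambda>(x, b) (y, c).
       if ract x b = y then bvec (x, b \<otimes>\<^bsub>F\<^esub> c) else 0),
     aone = (\<Sum>x\<in>carrier G. bvec (x, \<one>\<^bsub>F\<^esub>)),
     bcomult = linext X (\<lambda>(x, b).
       \<Sum>y\<in>carrier G. bvec (x \<otimes>\<^bsub>G\<^esub> inv\<^bsub>G\<^esub> y, lact y b) \<otimes>\<^sub>k bvec (y, b)),
     bcounit = (\<lambda>v. \<Sum>(x, b)\<in>X. v (x, b) * (if x = \<one>\<^bsub>G\<^esub> then 1 else 0))\<rparr>)"

text \<open>
  The coaction on the group algebra of \<open>F\<close> is the only one for which \<open>iota_F\<close> is a comodule map.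
\<close>

definition comod_F ::
  "('f, 'm) monoid_scheme \<Rightarrow> ('g, 'n) monoid_scheme \<Rightarrow> ('f \<times> 'g, 'f, 'k::field) comod_alg" where
  "comod_F F G = \<lparr>
     abasis = abasis (group_bialg F :: ('f, 'k) bialg),
     amult = amult (group_bialg F),
     aone = aone (group_bialg F),
     coact = linext (carrier F) (\<lambda>b. bvec (b, \<one>\<^bsub>G\<^esub>) \<otimes>\<^sub>k bvec b)\<rparr>"

definition mod_G ::
  "('f, 'm) monoid_scheme \<Rightarrow> ('g, 'n) monoid_scheme \<Rightarrow> ('g \<Rightarrow> 'f \<Rightarrow> 'g) \<Rightarrow>
   ('f \<times> 'g, 'g, 'k::field) mod_coalg" where
  "mod_G F G ract = \<lparr>
     cbasis = abasis (group_bialg G :: ('g, 'k) bialg),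
     ccomult = bcomult (group_bialg G),
     ccounit = bcounit (group_bialg G),
     act = bilext (carrier G) (carrier F \<times> carrier G)
       (\<lambda>x (b, y). bvec (ract x b \<otimes>\<^bsub>G\<^esub> y))\<rparr>"

definition iota_F ::
  "('f, 'm) monoid_scheme \<Rightarrow> ('g, 'n) monoid_scheme \<Rightarrow> ('f \<Rightarrow> 'k::field) \<Rightarrow> 'f \<times> 'g \<Rightarrow> 'k" where
  "iota_F F G = linext (carrier F) (\<lambda>b. bvec (b, \<one>\<^bsub>G\<^esub>))"

definition iota_G ::
  "('f, 'm) monoid_scheme \<Rightarrow> ('g, 'n) monoid_scheme \<Rightarrow> ('g \<Rightarrow> 'k::field) \<Rightarrow> 'f \<times> 'g \<Rightarrow> 'k" where
  "iota_G F G = linext (carrier G) (\<lambda>x. bvec (\<one>\<^bsub>F\<^esub>, x))"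

definition pi_F ::
  "('f, 'm) monoid_scheme \<Rightarrow> ('g, 'n) monoid_scheme \<Rightarrow> ('f \<times> 'g \<Rightarrow> 'k::field) \<Rightarrow> 'f \<Rightarrow> 'k" where
  "pi_F F G = linext (carrier F \<times> carrier G) (\<lambda>(b, x). bvec b)"

definition pi_G ::
  "('f, 'm) monoid_scheme \<Rightarrow> ('g, 'n) monoid_scheme \<Rightarrow> ('f \<times> 'g \<Rightarrow> 'k::field) \<Rightarrow> 'g \<Rightarrow> 'k" where
  "pi_G F G = linext (carrier F \<times> carrier G) (\<lambda>(b, x). bvec x)"

end

theory Submission
  imports Defs
begin

text \<open>
  Both \<open>k\<^sup>G # kF\<close> and the left partial dual live on the space with basis \<open>p\<^sub>x \<otimes> b\<close>, and the
  isomorphism is the identity: the structure maps agree on basis vectors, hence everywhere.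

  The comparison is a computation with Kronecker deltas, since the maps of the system send group
  elements to group elements.  The coaction on \<open>kF\<close> is \<open>b \<mapsto> (b, 1) \<otimes> b\<close>, and the dual coaction sends
  \<open>p\<^sub>z\<close> to the sum of the \<open>p\<^sub>x \<otimes> (b, w)\<^sup>*\<close> with \<open>(x \<lhd> b) w = z\<close> (lemma \<open>dual_coact_bvec\<close>).  In the
  product \<open>(p\<^sub>x # b)(p\<^sub>y # c)\<close> the pairing with \<open>(b, 1)\<close> therefore leaves \<open>p\<^sub>x # bc\<close> if \<open>x \<lhd> b = y\<close>, and
  \<open>0\<close> otherwise (lemma \<open>amult_D_bvec\<close>).  In the coproduct and in the associator \<open>\<gamma>\<^sup>*\<close> is applied to
  products \<open>(b, x)\<^sup>* \<zeta>\<^sup>*(c\<^sup>*)\<close> and to dual basis vectors \<open>(b, x)\<^sup>*\<close>.  The results vanish unless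
  \<open>b = c = 1\<close> and \<open>b = 1\<close>, respectively, because \<open>\<gamma> = \<iota>\<^sub>G\<close> takes its values in the span of the
  \<open>(1, y)\<close> (lemmas \<open>transposed_composite\<close> and \<open>transposed_iota_G_bvec\<close>).  This leaves
  \<open>\<Sum>\<^sub>y (p\<^bsub>xy\<inverse>\<^esub> # (y \<rhd> b)) \<otimes> (p\<^sub>y # b)\<close> for the coproduct (lemma \<open>bcomult_D_bvec\<close>).  In the inverse
  associator the remaining terms carry the index \<open>1 (x \<rhd> 1) = 1\<close>, so it is \<open>1 \<otimes> 1 \<otimes> 1\<close> (lemma
  \<open>inv_assoc_D\<close>) and the system is admissible.

  The axioms of a partially admissible system hold because \<open>F \<bowtie> G\<close> is a group in which every
  element factors as \<open>(b, x) = (b, 1)(1, x)\<close>; convolution inverses of maps from a group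
  algebra that send group elements to group elements are given by inverting the images.  The bismash
  product is checked to be a Hopf algebra directly, with antipode
  \<open>p\<^sub>x # b \<mapsto> p\<^bsub>(x \<lhd> b)\<inverse>\<^esub> # (x \<rhd> b)\<inverse>\<close>.  Two identities carry this.  The compatibility
  \<open>x \<lhd> b = (x y\<inverse> \<lhd> (y \<rhd> b)) (y \<lhd> b)\<close> makes the coproduct multiplicative (lemma
  \<open>split_product_condition\<close>), and the inversion rule
  \<open>(x \<lhd> b)\<inverse> \<lhd> (x \<rhd> b)\<inverse> = x\<inverse>\<close> gives the antipode law.
\<close>

section \<open>Linear maps compared on basis vectors\<close>

lemma sum_fun_apply: "(\<Sum>a\<in>A. f a) i = (\<Sum>a\<in>A. f a i)"
  by (induction A rule: infinite_finite_induct) auto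

text \<open>
  Linearity on the whole function space, not only on a \<open>vspace\<close>.  Maps defined by finite sums over
  a basis are linear in this stronger sense, and the notion composes with no membership side
  conditions.
\<close>

definition elinear :: "(('a \<Rightarrow> 'k::field) \<Rightarrow> 'b \<Rightarrow> 'k) \<Rightarrow> bool" where
  "elinear T \<longleftrightarrow> (\<forall>v w. T (v + w) = T v + T w) \<and> (\<forall>c v. T (c \<cdot> v) = c \<cdot> T v)"

definition eform :: "(('a \<Rightarrow> 'k::field) \<Rightarrow> 'k) \<Rightarrow> bool" where
  "eform e \<longleftrightarrow> (\<forall>v w. e (v + w) = e v + e w) \<and> (\<forall>c v. e (c \<cdot> v) = c * e v)"

lemma scal_0 [simp]: "c \<cdot> 0 = 0" "0 \<cdot> v = 0" and scal_1 [simp]: "1 \<cdot> v = v"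
  by (auto simp: scal_def fun_eq_iff)

lemma scal_add: "c \<cdot> (v + w) = c \<cdot> v + c \<cdot> w" "(c + d) \<cdot> v = c \<cdot> v + d \<cdot> v"
  by (auto simp: scal_def fun_eq_iff algebra_simps)

lemma scal_scal [simp]: "c \<cdot> d \<cdot> v = (c * d) \<cdot> v"
  by (auto simp: scal_def fun_eq_iff)

lemma scal_sum: "c \<cdot> (\<Sum>a\<in>A. f a) = (\<Sum>a\<in>A. c \<cdot> f a)"
  by (auto simp: scal_def fun_eq_iff sum_fun_apply sum_distrib_left)

lemma tensor_0 [simp]: "0 \<otimes>\<^sub>k v = 0" "v \<otimes>\<^sub>k 0 = 0"
  by (auto simp: tensor_def fun_eq_iff)

lemma tensor_bvec [simp]: "bvec i \<otimes>\<^sub>k bvec j = bvec (i, j)"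
  by (auto simp: tensor_def bvec_def fun_eq_iff)

lemma tensor_sum:
  "(\<Sum>a\<in>A. f a) \<otimes>\<^sub>k w = (\<Sum>a\<in>A. f a \<otimes>\<^sub>k w)"
  "v \<otimes>\<^sub>k (\<Sum>a\<in>A. f a) = (\<Sum>a\<in>A. v \<otimes>\<^sub>k f a)"
  by (auto simp: tensor_def fun_eq_iff sum_fun_apply sum_distrib_left sum_distrib_right)

lemma vspace_0 [simp]: "0 \<in> vspace I"
  and vspace_bvec [simp]: "(bvec i :: _ \<Rightarrow> 'k::field) \<in> vspace I \<longleftrightarrow> i \<in> I"
  and vspace_add: "v \<in> vspace I \<Longrightarrow> w \<in> vspace I \<Longrightarrow> v + w \<in> vspace I"
  and vspace_scal: "v \<in> vspace I \<Longrightarrow> c \<cdot> v \<in> vspace I"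
  and vspace_tensor: "v \<in> vspace I \<Longrightarrow> u \<in> vspace J \<Longrightarrow> v \<otimes>\<^sub>k u \<in> vspace (I \<times> J)"
  by (auto simp: vspace_def bvec_def scal_def tensor_def)

lemma vspace_sum: "(\<And>a. a \<in> A \<Longrightarrow> f a \<in> vspace I) \<Longrightarrow> (\<Sum>a\<in>A. f a) \<in> vspace I"
  by (auto simp: vspace_def sum_fun_apply)

lemma vspace_expand:
  assumes "finite I" "v \<in> vspace I"
  shows "v = (\<Sum>i\<in>I. v i \<cdot> bvec i)"
  using assms
  by (auto simp: fun_eq_iff sum_fun_apply scal_def bvec_def vspace_def if_distrib[of "\<lambda>c. _ * c"]
      cong: if_cong)

lemma elinear_0: "elinear T \<Longrightarrow> T 0 = 0"
  unfolding elinear_def by (metis scal_0(2))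

text \<open>
  For infinite \<open>A\<close> both sums are \<open>0\<close>.
\<close>

lemma elinear_sum:
  assumes "elinear T"
  shows "T (\<Sum>a\<in>A. f a) = (\<Sum>a\<in>A. T (f a))"
proof (induction A rule: infinite_finite_induct)
  case (insert a A)
  then show ?case
    using assms unfolding elinear_def sum.insert[OF insert(1,2)] by metis
qed (simp_all only: sum.infinite sum.empty elinear_0[OF assms] not_False_eq_True)

lemma elinear_scal: "elinear T \<Longrightarrow> T (c \<cdot> v) = c \<cdot> T v"
  by (simp add: elinear_def)

lemma elinear_expand:
  assumes "finite I" "v \<in> vspace I" "elinear T"
  shows "T v = (\<Sum>i\<in>I. v i \<cdot> T (bvec i))"
proof -
  have "T v = T (\<Sum>i\<in>I. v i \<cdot> bvec i)"
    using vspace_expand[OF assms(1,2)] by simp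
  then show ?thesis
    using assms(3) by (simp add: elinear_sum elinear_scal)
qed

lemma elinear_eqI:
  assumes "finite I" "v \<in> vspace I" "elinear T" "elinear S"
    and "\<And>i. i \<in> I \<Longrightarrow> T (bvec i) = S (bvec i)"
  shows "T v = S v"
  using assms by (simp add: elinear_expand[of I v])

text \<open>
  A functional is reduced to a linear map into a one-dimensional space, spanned by \<open>bvec ()\<close>.
\<close>

lemma eform_eqI:
  assumes "finite I" "v \<in> vspace I" "eform d" "eform e"
    and "\<And>i. i \<in> I \<Longrightarrow> d (bvec i) = e (bvec i)"
  shows "d v = e v"
proof -
  have "elinear (\<lambda>v. d v \<cdot> bvec ())" "elinear (\<lambda>v. e v \<cdot> bvec ())"
    using assms by (auto simp: elinear_def eform_def scal_add)
  then have "d v \<cdot> bvec () = e v \<cdot> bvec ()"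
    using elinear_eqI[of I v "\<lambda>v. d v \<cdot> bvec ()" "\<lambda>v. e v \<cdot> bvec ()"] assms by simp
  then show ?thesis
    by (auto simp: scal_def bvec_def fun_eq_iff)
qed

lemma elinear_eqI2:
  assumes "finite I" "finite J" "v \<in> vspace I" "w \<in> vspace J"
    and "\<And>w. elinear (\<lambda>v. T v w)" "\<And>w. elinear (\<lambda>v. S v w)"
    and "\<And>v. elinear (T v)" "\<And>v. elinear (S v)"
    and "\<And>i j. i \<in> I \<Longrightarrow> j \<in> J \<Longrightarrow> T (bvec i) (bvec j) = S (bvec i) (bvec j)"
  shows "T v w = S v w"
  by (rule elinear_eqI[OF assms(1,3,5,6)], rule elinear_eqI[OF assms(2,4,7,8)], rule assms(9))

lemma eform_eqI2:
  assumes "finite I" "finite J" "v \<in> vspace I" "w \<in> vspace J"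
    and "\<And>w. eform (\<lambda>v. T v w)" "\<And>w. eform (\<lambda>v. S v w)"
    and "\<And>v. eform (T v)" "\<And>v. eform (S v)"
    and "\<And>i j. i \<in> I \<Longrightarrow> j \<in> J \<Longrightarrow> T (bvec i) (bvec j) = S (bvec i) (bvec j)"
  shows "T v w = S v w"
  by (rule eform_eqI[OF assms(1,3,5,6)], rule eform_eqI[OF assms(2,4,7,8)], rule assms(9))

lemma vspace_elinear:
  assumes "finite I" "v \<in> vspace I" "elinear T" "\<And>i. i \<in> I \<Longrightarrow> T (bvec i) \<in> vspace J"
  shows "T v \<in> vspace J"
  using assms by (simp add: elinear_expand[of I v] vspace_sum vspace_scal)

lemma klinearI:
  assumes "finite I" "elinear T" "\<And>i. i \<in> I \<Longrightarrow> T (bvec i) \<in> vspace J"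
  shows "klinear I J T"
  using assms vspace_elinear[of I _ T J] by (auto simp: klinear_def elinear_def)

lemma kfunctionalI: "eform e \<Longrightarrow> kfunctional I e"
  by (auto simp: kfunctional_def eform_def)

lemma kbilinearI:
  fixes m :: "('a \<Rightarrow> 'k::field) \<Rightarrow> ('b \<Rightarrow> 'k) \<Rightarrow> 'c \<Rightarrow> 'k"
  assumes "finite I" "finite J" "\<And>w. elinear (\<lambda>v. m v w)" "\<And>v. elinear (m v)"
    and "\<And>i j. i \<in> I \<Longrightarrow> j \<in> J \<Longrightarrow> m (bvec i) (bvec j) \<in> vspace L"
  shows "kbilinear I J L m"
  unfolding kbilinear_def
proof (intro conjI ballI klinearI assms)
  fix v :: "'a \<Rightarrow> 'k" and j assume "v \<in> vspace I" "j \<in> J"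
  then show "m v (bvec j) \<in> vspace L"
    using vspace_elinear[OF assms(1) _ assms(3)] assms(5) by blast
next
  fix w :: "'b \<Rightarrow> 'k" and i assume "w \<in> vspace J" "i \<in> I"
  then show "m (bvec i) w \<in> vspace L"
    using vspace_elinear[OF assms(2) _ assms(4)] assms(5) by blast
qed

lemma elinear_id: "elinear (\<lambda>v. v)"
  by (simp add: elinear_def)

lemma elinear_scalar: "eform e \<Longrightarrow> elinear (\<lambda>v. e v \<cdot> w)"
  by (auto simp: eform_def elinear_def scal_add)

lemma elinear_linext: "elinear T \<Longrightarrow> elinear (\<lambda>v. linext I \<phi> (T v))"
  by (auto simp: elinear_def linext_def scal_def fun_eq_iff sum_fun_apply sum.distrib
      sum_distrib_left algebra_simps)

lemma elinear_bilext:
  "elinear T \<Longrightarrow> elinear (\<lambda>v. bilext I J \<phi> (T v) w)"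
  "elinear S \<Longrightarrow> elinear (\<lambda>v. bilext I J \<phi> u (S v))"
  by (auto simp: elinear_def bilext_def scal_def fun_eq_iff sum_fun_apply sum.distrib
      sum_distrib_left algebra_simps)

lemma elinear_tensor:
  "elinear T \<Longrightarrow> elinear (\<lambda>v. T v \<otimes>\<^sub>k w)"
  "elinear S \<Longrightarrow> elinear (\<lambda>v. u \<otimes>\<^sub>k S v)"
  by (auto simp: elinear_def tensor_def scal_def fun_eq_iff algebra_simps)

lemma elinear_sweedler:
  "elinear T \<Longrightarrow> elinear (\<lambda>v. sweedler I J (T v) m)"
  "(\<And>a b. elinear (\<lambda>v. n v a b)) \<Longrightarrow> elinear (\<lambda>v. sweedler I J t (n v))"
  by (auto simp: elinear_def sweedler_def scal_def fun_eq_iff sum_fun_apply sum.distrib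
      sum_distrib_left algebra_simps)

lemma elinear_tensor_alg:
  "elinear T \<Longrightarrow> elinear (\<lambda>v. amult (tensor_alg A D) (T v) w)"
  "elinear S \<Longrightarrow> elinear (\<lambda>v. amult (tensor_alg A D) u (S v))"
  by (auto simp: tensor_alg_def intro!: elinear_sweedler)

lemma eform_weighted_sum: "elinear T \<Longrightarrow> eform (\<lambda>v. \<Sum>i\<in>I. T v i * c i)"
  by (auto simp: eform_def elinear_def scal_def sum.distrib sum_distrib_left algebra_simps)

lemma eform_mult: "eform e \<Longrightarrow> eform (\<lambda>v. e v * c)" "eform e \<Longrightarrow> eform (\<lambda>v. c * e v)"
  by (auto simp: eform_def algebra_simps)

lemmas elinear_intros = elinear_id elinear_scalar elinear_linext elinear_bilext elinear_tensor
  elinear_sweedler elinear_tensor_alg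

lemma linext_bvec [simp]: "finite I \<Longrightarrow> i \<in> I \<Longrightarrow> linext I \<phi> (bvec i) = \<phi> i"
  by (auto simp: linext_def bvec_def scal_def fun_eq_iff sum_fun_apply if_distrib[of "\<lambda>c. c * _"]
      cong: if_cong)

lemma sweedler_eq_linext: "sweedler I J t m = linext (I \<times> J) (\<lambda>(i, j). m (bvec i) (bvec j)) t"
  by (simp add: sweedler_def linext_def sum.cartesian_product case_prod_unfold)

lemma bilext_eq_linext: "bilext I J \<phi> v w = linext I (\<lambda>i. linext J (\<phi> i) w) v"
  by (simp add: bilext_def linext_def scal_sum)

lemma bilext_bvec [simp]:
  "finite I \<Longrightarrow> finite J \<Longrightarrow> i \<in> I \<Longrightarrow> j \<in> J \<Longrightarrow> bilext I J \<phi> (bvec i) (bvec j) = \<phi> i j"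
  by (simp add: bilext_eq_linext)

lemma sweedler_bvec [simp]:
  "finite I \<Longrightarrow> finite J \<Longrightarrow> i \<in> I \<Longrightarrow> j \<in> J \<Longrightarrow> sweedler I J (bvec (i, j)) m = m (bvec i) (bvec j)"
  by (simp add: sweedler_eq_linext)

lemma tensor_alg_bvec [simp]:
  assumes "finite (abasis A)" "finite (abasis D)"
    and "i \<in> abasis A" "j \<in> abasis D" "i' \<in> abasis A" "j' \<in> abasis D"
  shows "amult (tensor_alg A D) (bvec (i, j)) (bvec (i', j')) =
    amult A (bvec i) (bvec i') \<otimes>\<^sub>k amult D (bvec j) (bvec j')"
  using assms by (simp add: tensor_alg_def)

text \<open>
  The structure maps commute with sums.  Together with their values on basis vectors this lets the
  simplifier expand Sweedler expressions into sums over group elements.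
\<close>

lemmas linext_sum = elinear_sum[OF elinear_linext[OF elinear_id]]
lemmas bilext_sum =
  elinear_sum[OF elinear_bilext(1)[OF elinear_id]] elinear_sum[OF elinear_bilext(2)[OF elinear_id]]
lemmas sweedler_sum = elinear_sum[OF elinear_sweedler(1)[OF elinear_id]]
lemmas tensor_alg_sum =
  elinear_sum[OF elinear_tensor_alg(1)[OF elinear_id]]
  elinear_sum[OF elinear_tensor_alg(2)[OF elinear_id]]
lemmas linext_0 [simp] = elinear_0[OF elinear_linext[OF elinear_id]]
lemmas bilext_0 [simp] =
  elinear_0[OF elinear_bilext(1)[OF elinear_id]] elinear_0[OF elinear_bilext(2)[OF elinear_id]]

definition ebilinear :: "(('a \<Rightarrow> 'k::field) \<Rightarrow> ('b \<Rightarrow> 'k) \<Rightarrow> 'c \<Rightarrow> 'k) \<Rightarrow> bool" where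
  "ebilinear m \<longleftrightarrow> (\<forall>v. elinear (m v)) \<and> (\<forall>w. elinear (\<lambda>v. m v w))"

lemma elinear_comp: "elinear T \<Longrightarrow> elinear S \<Longrightarrow> elinear (\<lambda>v. T (S v))"
  by (simp add: elinear_def)

lemma eform_comp: "eform e \<Longrightarrow> elinear S \<Longrightarrow> eform (\<lambda>v. e (S v))"
  by (simp add: elinear_def eform_def)

lemma ebilinear_compI:
  assumes "ebilinear m"
  shows "elinear T \<Longrightarrow> elinear (\<lambda>v. m (T v) w)" "elinear S \<Longrightarrow> elinear (\<lambda>v. m u (S v))"
  using assms elinear_comp[of "\<lambda>v. m v w" T] elinear_comp[of "m u" S]
  by (auto simp: ebilinear_def)

lemma ebilinear_bilext: "ebilinear (bilext I J \<phi>)"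
  by (simp add: ebilinear_def elinear_bilext[OF elinear_id])

lemma ebilinear_tensor_alg: "ebilinear (amult (tensor_alg A D))"
  by (simp add: ebilinear_def elinear_tensor_alg[OF elinear_id])

lemma eform_of_sum:
  assumes "eform e"
  shows "e (\<Sum>a\<in>A. f a) = (\<Sum>a\<in>A. e (f a))"
proof -
  have "elinear (\<lambda>v. e v \<cdot> bvec ())"
    using assms by (rule elinear_scalar)
  from elinear_sum[OF this, of f A] show ?thesis
    by (auto simp: fun_eq_iff sum_fun_apply scal_def bvec_def)
qed

lemma weighted_sum_bvec [simp]:
  "finite I \<Longrightarrow> i \<in> I \<Longrightarrow> (\<Sum>j\<in>I. bvec i j * c j) = (c i :: 'k::field)"
  by (simp add: bvec_def if_distrib[of "\<lambda>a. a * _"] cong: if_cong)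

lemma eform_weighted_sum_plain [simp]: "eform (\<lambda>v. \<Sum>i\<in>I. v i * c i)"
  using eform_weighted_sum[OF elinear_id] .

lemma tensor_if: "v \<otimes>\<^sub>k (if P then w else 0) = (if P then v \<otimes>\<^sub>k w else 0)"
  by simp

lemma linext_cong: "(\<And>i. i \<in> I \<Longrightarrow> \<phi> i = \<psi> i) \<Longrightarrow> linext I \<phi> v = linext I \<psi> v"
  by (simp add: linext_def)

text \<open>
  The product of the left partial dual is written with nested Sweedler sums, that of the bismash
  product as a bilinear extension; both depend only on the values on basis vectors.
\<close>

lemma sweedler2_eq_bilext:
  assumes "\<And>x b y c. x \<in> L \<Longrightarrow> b \<in> J \<Longrightarrow> y \<in> L \<Longrightarrow> c \<in> J \<Longrightarrow>
    m (bvec x) (bvec b) (bvec y) (bvec c) = \<phi> (x, b) (y, c)"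
  shows "sweedler L J s (\<lambda>f b. sweedler L J t (m f b)) = bilext (L \<times> J) (L \<times> J) \<phi> s t"
  unfolding sweedler_eq_linext bilext_eq_linext
  by (rule linext_cong) (auto intro!: linext_cong assms)

lemma tensor_sum2:
  "v \<otimes>\<^sub>k (\<Sum>a\<in>I. f a) \<otimes>\<^sub>k (\<Sum>b\<in>J. g b) = (\<Sum>a\<in>I. \<Sum>b\<in>J. v \<otimes>\<^sub>k f a \<otimes>\<^sub>k g b)"
  by (simp only: tensor_sum) (rule sum.swap)

lemma pairing_bvec [simp]:
  "finite I \<Longrightarrow> i \<in> I \<Longrightarrow> pairing I f (bvec i) = f i"
  by (simp add: pairing_def bvec_def if_distrib[of "\<lambda>c. _ * c"] cong: if_cong)

lemma bvec_apply: "bvec i j = (if j = i then 1 else 0)"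
  by (simp add: bvec_def)

text \<open>
  In nested sums over Kronecker deltas this moves a condition outwards, to the sum over the variable
  that it constrains.
\<close>

lemma sum_if_const: "(\<Sum>a\<in>A. if P then f a else 0) = (if P then \<Sum>a\<in>A. f a else 0)"
  by simp

lemma sum_bvec [simp]: "finite I \<Longrightarrow> i \<in> I \<Longrightarrow> (\<Sum>j\<in>I. bvec i j) = (1::'k::field)"
  by (simp add: bvec_def)

lemma eform_sum: "eform (\<lambda>v. \<Sum>g\<in>I. v g)"
  by (simp add: eform_def scal_def sum.distrib sum_distrib_left)

lemma elinear_linext_plain [simp]: "elinear (linext I \<phi>)"
  using elinear_linext[OF elinear_id] .

lemma linext_bvec_id:
  assumes "finite I" "v \<in> vspace I"
  shows "linext I bvec v = v"
  using vspace_expand[OF assms] by (simp add: linext_def)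

section \<open>Structures verified on a basis\<close>

lemma coalg_of_simps [simp]:
  "cbasis (coalg_of H) = abasis H"
  "ccomult (coalg_of H) = bcomult H"
  "ccounit (coalg_of H) = bcounit H"
  by (simp_all add: coalg_of_def)

text \<open>
  This criterion and those that follow reduce the axioms of a structure to identities between
  basis vectors, by multilinearity of both sides.
\<close>

lemma k_algebraI:
  fixes A :: "('a, 'k::field, 'm) alg_scheme"
  assumes fin: "finite (abasis A)" and mult: "ebilinear (amult A)"
    and one: "aone A \<in> vspace (abasis A)"
    and closed: "\<And>i j. i \<in> abasis A \<Longrightarrow> j \<in> abasis A \<Longrightarrow>
      amult A (bvec i) (bvec j) \<in> vspace (abasis A)"
    and unit: "\<And>i. i \<in> abasis A \<Longrightarrow> amult A (aone A) (bvec i) = bvec i"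
      "\<And>i. i \<in> abasis A \<Longrightarrow> amult A (bvec i) (aone A) = bvec i"
    and assoc: "\<And>i j l. i \<in> abasis A \<Longrightarrow> j \<in> abasis A \<Longrightarrow> l \<in> abasis A \<Longrightarrow>
      amult A (amult A (bvec i) (bvec j)) (bvec l) = amult A (bvec i) (amult A (bvec j) (bvec l))"
  shows "k_algebra A"
  unfolding k_algebra_def
proof (intro conjI ballI)
  note lin = ebilinear_compI[OF mult] elinear_id
  show "kbilinear (abasis A) (abasis A) (abasis A) (amult A)"
    using mult by (intro kbilinearI fin closed) (auto simp: ebilinear_def)
  show "amult A (aone A) a = a" "amult A a (aone A) = a" if "a \<in> vspace (abasis A)" for a
    by (rule elinear_eqI[OF fin that]; intro lin unit; assumption)+
  fix a b c :: "'a \<Rightarrow> 'k"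
  assume abc: "a \<in> vspace (abasis A)" "b \<in> vspace (abasis A)" "c \<in> vspace (abasis A)"
  show "amult A (amult A a b) c = amult A a (amult A b c)"
  proof (rule elinear_eqI[OF fin abc(1)])
    fix i assume i: "i \<in> abasis A"
    show "amult A (amult A (bvec i) b) c = amult A (bvec i) (amult A b c)"
      by (rule elinear_eqI2[OF fin fin abc(2,3)]) (intro lin assoc i; assumption)+
  qed (intro lin)+
qed (use fin one in auto)

lemma algebra_mapI:
  fixes A :: "('a, 'k::field, 'm) alg_scheme"
  assumes "finite (abasis A)" "ebilinear (amult A)" "ebilinear (amult D)" "elinear T"
    and "\<And>i. i \<in> abasis A \<Longrightarrow> T (bvec i) \<in> vspace (abasis D)"
    and "T (aone A) = aone D"
    and "\<And>i j. i \<in> abasis A \<Longrightarrow> j \<in> abasis A \<Longrightarrow>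
      T (amult A (bvec i) (bvec j)) = amult D (T (bvec i)) (T (bvec j))"
  shows "algebra_map A D T"
  unfolding algebra_map_def
proof (intro conjI ballI)
  fix a b :: "'a \<Rightarrow> 'k" assume ab: "a \<in> vspace (abasis A)" "b \<in> vspace (abasis A)"
  show "T (amult A a b) = amult D (T a) (T b)"
    by (rule elinear_eqI2[OF assms(1,1) ab])
       (intro elinear_comp[OF assms(4)] ebilinear_compI[OF assms(2)] ebilinear_compI[OF assms(3)]
         elinear_id assms(4,7); assumption)+
qed (use assms in \<open>auto intro: klinearI\<close>)

lemma k_coalgebraI:
  assumes fin: "finite (cbasis C)" and comult: "elinear (ccomult C)" and counit: "eform (ccounit C)"
    and closed: "\<And>i. i \<in> cbasis C \<Longrightarrow> ccomult C (bvec i) \<in> vspace (cbasis C \<times> cbasis C)"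
    and "\<And>i. i \<in> cbasis C \<Longrightarrow>
      sweedler (cbasis C) (cbasis C) (ccomult C (bvec i)) (\<lambda>x1 x2. ccounit C x1 \<cdot> x2) = bvec i"
    and "\<And>i. i \<in> cbasis C \<Longrightarrow>
      sweedler (cbasis C) (cbasis C) (ccomult C (bvec i)) (\<lambda>x1 x2. ccounit C x2 \<cdot> x1) = bvec i"
    and "\<And>i. i \<in> cbasis C \<Longrightarrow>
      sweedler (cbasis C) (cbasis C) (ccomult C (bvec i)) (\<lambda>y z.
        sweedler (cbasis C) (cbasis C) (ccomult C y) (\<lambda>y1 y2. y1 \<otimes>\<^sub>k y2 \<otimes>\<^sub>k z)) =
      sweedler (cbasis C) (cbasis C) (ccomult C (bvec i)) (\<lambda>y z.
        sweedler (cbasis C) (cbasis C) (ccomult C z) (\<lambda>z1 z2. y \<otimes>\<^sub>k z1 \<otimes>\<^sub>k z2))"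
  shows "k_coalgebra C"
  unfolding k_coalgebra_def Let_def
  by (intro conjI ballI fin klinearI kfunctionalI comult counit closed finite_cartesian_product;
      (assumption | rule elinear_eqI[OF fin], assumption; intro assms elinear_intros comult; assumption))

lemma coalgebra_mapI:
  fixes C :: "('c, 'k::field, 'm) coalg_scheme"
  assumes fin: "finite (cbasis C)" and "elinear (ccomult C)" "eform (ccounit C)"
    and "elinear (ccomult D)" "eform (ccounit D)" "elinear T"
    and "\<And>i. i \<in> cbasis C \<Longrightarrow> T (bvec i) \<in> vspace (cbasis D)"
    and counit: "\<And>i. i \<in> cbasis C \<Longrightarrow> ccounit D (T (bvec i)) = ccounit C (bvec i)"
    and comult: "\<And>i. i \<in> cbasis C \<Longrightarrow> ccomult D (T (bvec i)) =
      sweedler (cbasis C) (cbasis C) (ccomult C (bvec i)) (\<lambda>x1 x2. T x1 \<otimes>\<^sub>k T x2)"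
  shows "coalgebra_map C D T"
  unfolding coalgebra_map_def
proof (intro conjI ballI)
  fix x :: "'c \<Rightarrow> 'k" assume x: "x \<in> vspace (cbasis C)"
  show "ccounit D (T x) = ccounit C x"
    by (rule eform_eqI[OF fin x]) (use assms in \<open>auto intro: eform_comp\<close>)
  show "ccomult D (T x) =
      sweedler (cbasis C) (cbasis C) (ccomult C x) (\<lambda>x1 x2. T x1 \<otimes>\<^sub>k T x2)"
    by (rule elinear_eqI[OF fin x])
       (use assms in \<open>auto intro: elinear_comp[of "ccomult D" T] elinear_sweedler(1)\<close>)
qed (use assms in \<open>auto intro: klinearI\<close>)

lemma k_bialgebraI:
  fixes H :: "('a, 'k::field, 'm) bialg_scheme"
  assumes "k_algebra H" "k_coalgebra (coalg_of H)"
    and fin: "finite (abasis H)" and mult: "ebilinear (amult H)"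
    and comult: "elinear (bcomult H)" and counit: "eform (bcounit H)"
    and closed: "\<And>i. i \<in> abasis H \<Longrightarrow> bcomult H (bvec i) \<in> vspace (abasis H \<times> abasis H)"
    and one: "bcomult H (aone H) = aone H \<otimes>\<^sub>k aone H" "bcounit H (aone H) = 1"
    and comult_mult: "\<And>i j. i \<in> abasis H \<Longrightarrow> j \<in> abasis H \<Longrightarrow>
      bcomult H (amult H (bvec i) (bvec j)) =
      amult (tensor_alg H H) (bcomult H (bvec i)) (bcomult H (bvec j))"
    and counit_mult: "\<And>i j. i \<in> abasis H \<Longrightarrow> j \<in> abasis H \<Longrightarrow>
      bcounit H (amult H (bvec i) (bvec j)) = bcounit H (bvec i) * bcounit H (bvec j)"
  shows "k_bialgebra H"
  unfolding k_bialgebra_def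
proof (intro conjI ballI)
  show "algebra_map H (tensor_alg H H) (bcomult H)"
    using assms by (intro algebra_mapI fin mult ebilinear_tensor_alg) (auto simp: tensor_alg_def)
  fix a b :: "'a \<Rightarrow> 'k" assume ab: "a \<in> vspace (abasis H)" "b \<in> vspace (abasis H)"
  show "bcounit H (amult H a b) = bcounit H a * bcounit H b"
    by (rule eform_eqI2[OF fin fin ab])
       (intro eform_comp[OF counit] eform_mult ebilinear_compI[OF mult] elinear_id counit
         counit_mult; assumption)+
qed (use assms in auto)

lemma conv_inverseI:
  assumes fin: "finite (cbasis C)" and comult: "elinear (ccomult C)" and counit: "eform (ccounit C)"
    and S: "elinear S" "\<And>i. i \<in> cbasis C \<Longrightarrow> S (bvec i) \<in> vspace (abasis A)"
    and T: "elinear T" "\<And>i. i \<in> cbasis C \<Longrightarrow> T (bvec i) \<in> vspace (abasis A)"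
    and "\<And>i. i \<in> cbasis C \<Longrightarrow>
      sweedler (cbasis C) (cbasis C) (ccomult C (bvec i)) (\<lambda>x1 x2. amult A (S x1) (T x2)) =
      ccounit C (bvec i) \<cdot> aone A"
    and "\<And>i. i \<in> cbasis C \<Longrightarrow>
      sweedler (cbasis C) (cbasis C) (ccomult C (bvec i)) (\<lambda>x1 x2. amult A (T x1) (S x2)) =
      ccounit C (bvec i) \<cdot> aone A"
  shows "conv_inverse C A S T"
  unfolding conv_inverse_def
  by (intro conjI ballI klinearI fin S T;
      (assumption | rule elinear_eqI[OF fin], assumption;
        intro assms elinear_intros comult counit; assumption))

text \<open>
  A convolution inverse only sees the values on the \<open>vspace\<close>; the identity map may thus be replaced by
  the linear extension of the basis vectors.
\<close>

lemma conv_inverse_cong: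
  assumes "conv_inverse C A S T" "\<And>x. x \<in> vspace (cbasis C) \<Longrightarrow> T x = T' x" "finite (cbasis C)"
  shows "conv_inverse C A S T'"
proof -
  have "sweedler (cbasis C) (cbasis C) t (\<lambda>x1 x2. amult A (S x1) (T' x2)) =
      sweedler (cbasis C) (cbasis C) t (\<lambda>x1 x2. amult A (S x1) (T x2))"
    "sweedler (cbasis C) (cbasis C) t (\<lambda>x1 x2. amult A (T' x1) (S x2)) =
      sweedler (cbasis C) (cbasis C) t (\<lambda>x1 x2. amult A (T x1) (S x2))" for t
    using assms(2) by (auto simp: sweedler_def intro!: sum.cong)
  moreover have "klinear (cbasis C) (abasis A) T'"
    using assms(1) by (simp add: conv_inverse_def klinear_def vspace_add vspace_scal flip: assms(2))
  ultimately show ?thesis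
    using assms(1) by (simp add: conv_inverse_def)
qed

text \<open>
  The dual of a coalgebra with a group-like basis is the algebra of functions on that basis.
\<close>

lemma amult_dual_alg:
  assumes "finite (cbasis D)" "ccomult D = linext (cbasis D) (\<lambda>x. bvec (x, x))"
  shows "amult (dual_alg D) f g = (\<lambda>x. if x \<in> cbasis D then f x * g x else 0)"
  using assms by (auto simp: dual_alg_def tensor_def)

lemma tensor_alg_tensor:
  assumes fin: "finite (abasis A)" "finite (abasis E)" and mult: "ebilinear (amult A)" "ebilinear (amult E)"
    and a: "a \<in> vspace (abasis A)" "a' \<in> vspace (abasis A)"
    and e: "e \<in> vspace (abasis E)" "e' \<in> vspace (abasis E)"
  shows "amult (tensor_alg A E) (a \<otimes>\<^sub>k e) (a' \<otimes>\<^sub>k e') = amult A a a' \<otimes>\<^sub>k amult E e e'"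
proof -
  note lin = elinear_tensor elinear_tensor_alg ebilinear_compI[OF mult(1)] ebilinear_compI[OF mult(2)]
    elinear_id
  show ?thesis
  proof (rule elinear_eqI2[OF fin a(1) e(1)])
    fix i j assume i: "i \<in> abasis A" and j: "j \<in> abasis E"
    show "amult (tensor_alg A E) (bvec i \<otimes>\<^sub>k bvec j) (a' \<otimes>\<^sub>k e') =
        amult A (bvec i) a' \<otimes>\<^sub>k amult E (bvec j) e'"
      by (rule elinear_eqI2[OF fin a(2) e(2)]) (use fin i j in \<open>auto intro!: lin\<close>)
  qed (intro lin)+
qed

text \<open>
  Since the inverse of the unit is the unit, it suffices that \<open>1 \<otimes> 1 \<otimes> 1\<close> is idempotent.
\<close>

lemma is_associator_one:
  assumes alg: "k_algebra E" and mult: "ebilinear (amult E)"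
    and trivial: "inv_assoc E = aone E \<otimes>\<^sub>k aone E \<otimes>\<^sub>k aone E"
  shows "is_associator E (aone E \<otimes>\<^sub>k aone E \<otimes>\<^sub>k aone E)"
proof -
  let ?E2 = "tensor_alg E E"
  have fin: "finite (abasis E)" and one: "aone E \<in> vspace (abasis E)"
    and idem: "amult E (aone E) (aone E) = aone E"
    using alg by (auto simp: k_algebra_def)
  have fin2: "finite (abasis ?E2)" and one2: "aone E \<otimes>\<^sub>k aone E \<in> vspace (abasis ?E2)"
    using fin one by (auto simp: tensor_alg_def intro!: vspace_tensor)
  have "amult ?E2 (aone E \<otimes>\<^sub>k aone E) (aone E \<otimes>\<^sub>k aone E) = aone E \<otimes>\<^sub>k aone E"
    using tensor_alg_tensor[OF fin fin mult mult one one one one] by (simp add: idem)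
  then have "amult (tensor_alg E ?E2) (aone E \<otimes>\<^sub>k aone E \<otimes>\<^sub>k aone E) (aone E \<otimes>\<^sub>k aone E \<otimes>\<^sub>k aone E) =
      aone E \<otimes>\<^sub>k aone E \<otimes>\<^sub>k aone E"
    using tensor_alg_tensor[OF fin fin2 mult ebilinear_tensor_alg one one one2 one2]
    by (simp add: idem)
  moreover have "aone (tensor_alg E ?E2) = aone E \<otimes>\<^sub>k aone E \<otimes>\<^sub>k aone E"
    by (simp add: tensor_alg_def)
  moreover have "aone E \<otimes>\<^sub>k aone E \<otimes>\<^sub>k aone E \<in> vspace (abasis (tensor_alg E ?E2))"
    using one by (auto simp: tensor_alg_def intro!: vspace_tensor)
  ultimately show ?thesis
    by (simp add: is_associator_def trivial)
qed

section \<open>Group algebras\<close>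

lemma group_bialg_simps [simp]:
  "abasis (group_bialg K) = carrier K"
  "amult (group_bialg K) = bilext (carrier K) (carrier K) (\<lambda>g h. bvec (g \<otimes>\<^bsub>K\<^esub> h))"
  "aone (group_bialg K) = bvec \<one>\<^bsub>K\<^esub>"
  "bcomult (group_bialg K) = linext (carrier K) (\<lambda>g. bvec (g, g))"
  "bcounit (group_bialg K) = (\<lambda>v. \<Sum>g\<in>carrier K. v g)"
  by (simp_all add: group_bialg_def)

lemma k_algebra_group:
  assumes "group K" "finite (carrier K)"
  shows "k_algebra (group_bialg K)"
proof -
  interpret group K by fact
  show ?thesis
    using assms(2) by (intro k_algebraI) (auto simp: ebilinear_bilext m_assoc)
qed

lemma k_coalgebra_group:
  assumes "finite (carrier K)"
  shows "k_coalgebra (coalg_of (group_bialg K))"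
  using assms by (intro k_coalgebraI) (auto simp: eform_sum)

text \<open>
  On a group-like element \<open>i\<close> convolution is the product of the values at \<open>i\<close>, so a map into group
  elements is inverted pointwise.  This one fact yields the antipode of a group algebra and the
  invertibility of \<open>\<zeta>\<close> and \<open>\<gamma>\<close>.
\<close>

lemma conv_inverse_grouplike:
  assumes "group K" "finite (carrier L)" "finite (carrier K)" "\<And>i. i \<in> carrier L \<Longrightarrow> \<phi> i \<in> carrier K"
  shows "conv_inverse (coalg_of (group_bialg L)) (group_bialg K)
    (linext (carrier L) (\<lambda>i. bvec (inv\<^bsub>K\<^esub> \<phi> i))) (linext (carrier L) (\<lambda>i. bvec (\<phi> i)))"
proof -
  interpret group K by fact
  show ?thesis
    using assms by (intro conv_inverseI) (auto simp: eform_sum)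
qed

lemma hopf_algebra_group:
  assumes "group K" "finite (carrier K)"
  shows "hopf_algebra (group_bialg K :: ('a, 'k::field) bialg)"
proof -
  interpret group K by fact
  have "k_bialgebra (group_bialg K)"
    using assms
    by (intro k_bialgebraI k_algebra_group k_coalgebra_group)
       (auto simp: eform_sum ebilinear_bilext)
  moreover have "conv_inverse (coalg_of (group_bialg K)) (group_bialg K)
      (linext (carrier K) (\<lambda>g. bvec (inv\<^bsub>K\<^esub> g))) (\<lambda>h :: 'a \<Rightarrow> 'k. h)"
    using assms(2)
    by (intro conv_inverse_cong[OF conv_inverse_grouplike[OF assms(1,2,2), of "\<lambda>g. g"]])
       (auto simp: linext_bvec_id)
  ultimately show ?thesis
    by (auto simp: hopf_algebra_def)
qed

section \<open>Matched pairs of groups\<close>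

context matched_pair
begin

declare lact_closed [simp, intro] ract_closed [simp, intro] lact_one [simp] ract_one [simp]

text \<open>
  The compatibility condition at \<open>b = c = 1\<close> makes \<open>x \<rhd> 1\<close> idempotent in \<open>F\<close>.
\<close>

lemma lact_unit [simp]:
  assumes "x \<in> carrier G"
  shows "x \<rhd> \<one>\<^bsub>F\<^esub> = \<one>\<^bsub>F\<^esub>"
  using lact_match[OF assms, of "\<one>\<^bsub>F\<^esub>" "\<one>\<^bsub>F\<^esub>"] assms by simp

lemma ract_unit [simp]:
  assumes "b \<in> carrier F"
  shows "\<one>\<^bsub>G\<^esub> \<lhd> b = \<one>\<^bsub>G\<^esub>"
  using ract_match[of "\<one>\<^bsub>G\<^esub>" "\<one>\<^bsub>G\<^esub>" b] assms by simp

text \<open>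
  Expand \<open>1 \<lhd> b = (x\<inverse> x) \<lhd> b\<close>.
\<close>

lemma inv_ract:
  assumes "x \<in> carrier G" "b \<in> carrier F"
  shows "inv\<^bsub>G\<^esub> (x \<lhd> b) = inv\<^bsub>G\<^esub> x \<lhd> (x \<rhd> b)"
  using ract_match[of "inv\<^bsub>G\<^esub> x" x b] assms by (simp add: G.inv_equality)

lemma ract_eq_iff:
  assumes "x \<in> carrier G" "y \<in> carrier G" "b \<in> carrier F"
  shows "x \<lhd> b = y \<longleftrightarrow> x = y \<lhd> inv\<^bsub>F\<^esub> b"
  using assms ract_mult[of x b "inv\<^bsub>F\<^esub> b"] ract_mult[of y "inv\<^bsub>F\<^esub> b" b] by auto

abbreviation K where "K \<equiv> bowtie F G (\<rhd>) (\<lhd>)"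

lemma bowtie_simps [simp]:
  "carrier K = carrier F \<times> carrier G"
  "(b, x) \<otimes>\<^bsub>K\<^esub> (c, y) = (b \<otimes>\<^bsub>F\<^esub> (x \<rhd> c), (x \<lhd> c) \<otimes>\<^bsub>G\<^esub> y)"
  "\<one>\<^bsub>K\<^esub> = (\<one>\<^bsub>F\<^esub>, \<one>\<^bsub>G\<^esub>)"
  by (simp_all add: bowtie_def)

lemma group_bowtie: "group K"
proof (rule groupI)
  fix g h k assume "g \<in> carrier K" "h \<in> carrier K" "k \<in> carrier K"
  then show "g \<otimes>\<^bsub>K\<^esub> h \<otimes>\<^bsub>K\<^esub> k = g \<otimes>\<^bsub>K\<^esub> (h \<otimes>\<^bsub>K\<^esub> k)"
    by (auto simp: lact_match ract_match lact_mult ract_mult F.m_assoc G.m_assoc)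
next
  fix g assume "g \<in> carrier K"
  then obtain b x where g: "g = (b, x)" "b \<in> carrier F" "x \<in> carrier G"
    by auto
  \<comment> \<open>The inverse of \<open>(b, 1)(1, x)\<close> is \<open>(1, x\<inverse>)(b\<inverse>, 1)\<close>, whose \<open>G\<close>-component is \<open>x\<inverse> \<lhd> b\<inverse>\<close>.\<close>
  let ?y = "inv\<^bsub>G\<^esub> x \<lhd> inv\<^bsub>F\<^esub> b"
  have "?y \<lhd> b = inv\<^bsub>G\<^esub> x"
    using g by (simp flip: ract_mult)
  then show "\<exists>h\<in>carrier K. h \<otimes>\<^bsub>K\<^esub> g = \<one>\<^bsub>K\<^esub>"
    using g by (intro bexI[of _ "(inv\<^bsub>F\<^esub> (?y \<rhd> b), ?y)"]) auto
qed auto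

end

locale finite_matched_pair = matched_pair F G lact ract
  for F :: "('f, 'm) monoid_scheme" and G :: "('g, 'n) monoid_scheme"
    and lact (infixr "\<rhd>" 75) and ract (infixl "\<lhd>" 75) +
  assumes finF [simp]: "finite (carrier F)" and finG [simp]: "finite (carrier G)"

lemma (in group) sum_right_translate:
  assumes "z \<in> carrier G"
  shows "(\<Sum>y\<in>carrier G. f (y \<otimes> z)) = (\<Sum>y\<in>carrier G. f y)"
  using assms
  by (intro sum.reindex_bij_witness[of _ "\<lambda>y. y \<otimes> inv z" "\<lambda>y. y \<otimes> z"]) (auto simp: m_assoc)

section \<open>The bismash product is a Hopf algebra\<close>

context finite_matched_pair
begin

abbreviation A where "A \<equiv> bismash F G (\<rhd>) (\<lhd>)"

lemma bismash_simps [simp]: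
  "abasis A = carrier G \<times> carrier F"
  "amult A = bilext (carrier G \<times> carrier F) (carrier G \<times> carrier F)
    (\<lambda>(x, b) (y, c). if x \<lhd> b = y then bvec (x, b \<otimes>\<^bsub>F\<^esub> c) else 0)"
  "aone A = (\<Sum>x\<in>carrier G. bvec (x, \<one>\<^bsub>F\<^esub>))"
  "bcomult A = linext (carrier G \<times> carrier F)
    (\<lambda>(x, b). \<Sum>y\<in>carrier G. bvec ((x \<otimes>\<^bsub>G\<^esub> inv\<^bsub>G\<^esub> y, y \<rhd> b), (y, b)))"
  "bcounit A = (\<lambda>v. \<Sum>p\<in>carrier G \<times> carrier F. v p * (if fst p = \<one>\<^bsub>G\<^esub> then 1 else 0))"
  by (simp_all add: bismash_def Let_def case_prod_unfold)

lemma k_algebra_bismash: "k_algebra A"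
  by (intro k_algebraI)
     (auto simp: ebilinear_bilext bilext_sum ract_mult F.m_assoc intro!: vspace_sum)

text \<open>
  Coassociativity is the substitution \<open>y \<mapsto> y z\<close> in a double sum over \<open>G\<close>.
\<close>

lemma k_coalgebra_bismash: "k_coalgebra (coalg_of A)"
proof (intro k_coalgebraI)
  fix p assume "p \<in> cbasis (coalg_of A)"
  then obtain x b where p: "p = (x, b)" and x: "x \<in> carrier G" and b: "b \<in> carrier F"
    by auto
  have "(\<Sum>y\<in>carrier G. \<Sum>z\<in>carrier G.
      bvec (((x \<otimes>\<^bsub>G\<^esub> inv\<^bsub>G\<^esub> y) \<otimes>\<^bsub>G\<^esub> inv\<^bsub>G\<^esub> z, z \<rhd> y \<rhd> b), (z, y \<rhd> b), (y, b))) =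
    (\<Sum>z\<in>carrier G. \<Sum>y\<in>carrier G.
      bvec ((x \<otimes>\<^bsub>G\<^esub> inv\<^bsub>G\<^esub> (y \<otimes>\<^bsub>G\<^esub> z), (y \<otimes>\<^bsub>G\<^esub> z) \<rhd> b), ((y \<otimes>\<^bsub>G\<^esub> z) \<otimes>\<^bsub>G\<^esub> inv\<^bsub>G\<^esub> z, z \<rhd> b), (z, b)))"
    using x b
    by (intro sum.cong refl) (auto simp: G.inv_mult_group G.m_assoc lact_mult)
  also have "\<dots> = (\<Sum>z\<in>carrier G. \<Sum>y\<in>carrier G.
      bvec ((x \<otimes>\<^bsub>G\<^esub> inv\<^bsub>G\<^esub> y, y \<rhd> b), (y \<otimes>\<^bsub>G\<^esub> inv\<^bsub>G\<^esub> z, z \<rhd> b), (z, b)))"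
    by (intro sum.cong refl G.sum_right_translate
        [where f = "\<lambda>y. bvec ((x \<otimes>\<^bsub>G\<^esub> inv\<^bsub>G\<^esub> y, y \<rhd> b), (y \<otimes>\<^bsub>G\<^esub> inv\<^bsub>G\<^esub> _, _ \<rhd> b), (_, b))"])
  also have "\<dots> = (\<Sum>y\<in>carrier G. \<Sum>z\<in>carrier G.
      bvec ((x \<otimes>\<^bsub>G\<^esub> inv\<^bsub>G\<^esub> y, y \<rhd> b), (y \<otimes>\<^bsub>G\<^esub> inv\<^bsub>G\<^esub> z, z \<rhd> b), (z, b)))"
    by (rule sum.swap)
  finally show "sweedler (cbasis (coalg_of A)) (cbasis (coalg_of A)) (ccomult (coalg_of A) (bvec p))
      (\<lambda>y z. sweedler (cbasis (coalg_of A)) (cbasis (coalg_of A)) (ccomult (coalg_of A) y)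
        (\<lambda>y1 y2. y1 \<otimes>\<^sub>k y2 \<otimes>\<^sub>k z)) =
    sweedler (cbasis (coalg_of A)) (cbasis (coalg_of A)) (ccomult (coalg_of A) (bvec p))
      (\<lambda>y z. sweedler (cbasis (coalg_of A)) (cbasis (coalg_of A)) (ccomult (coalg_of A) z)
        (\<lambda>z1 z2. y \<otimes>\<^sub>k z1 \<otimes>\<^sub>k z2))"
    using x b by (simp add: p sweedler_sum)
next
  fix p assume "p \<in> cbasis (coalg_of A)"
  then obtain x b where p: "p = (x, b)" and x: "x \<in> carrier G" and b: "b \<in> carrier F"
    by auto
  have *: "x \<otimes>\<^bsub>G\<^esub> inv\<^bsub>G\<^esub> y = \<one>\<^bsub>G\<^esub> \<longleftrightarrow> y = x" if "y \<in> carrier G" for y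
    using that x by (metis G.inv_closed G.inv_equality G.inv_inv G.r_inv)
  show "sweedler (cbasis (coalg_of A)) (cbasis (coalg_of A)) (ccomult (coalg_of A) (bvec p))
      (\<lambda>x1 x2. ccounit (coalg_of A) x1 \<cdot> x2) = bvec p"
    using x b by (simp add: p sweedler_sum * if_distrib[of "\<lambda>c. c \<cdot> _"] cong: if_cong)
  show "sweedler (cbasis (coalg_of A)) (cbasis (coalg_of A)) (ccomult (coalg_of A) (bvec p))
      (\<lambda>x1 x2. ccounit (coalg_of A) x2 \<cdot> x1) = bvec p"
    using x b by (simp add: p sweedler_sum if_distrib[of "\<lambda>c. c \<cdot> _"] cong: if_cong)
qed (auto intro!: vspace_sum)

text \<open>
  The left-hand side is the condition under which the first tensor factors of \<open>\<Delta>(p\<^sub>x # b)\<close> and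
  \<open>\<Delta>(p\<^sub>y # c)\<close> have a nonzero product once the second factors have one.  It is independent of the
  summation index \<open>z\<close>.
\<close>

lemma split_product_condition:
  assumes "x \<in> carrier G" "y \<in> carrier G" "z \<in> carrier G" "b \<in> carrier F"
  shows "(x \<otimes>\<^bsub>G\<^esub> inv\<^bsub>G\<^esub> z) \<lhd> (z \<rhd> b) = y \<otimes>\<^bsub>G\<^esub> inv\<^bsub>G\<^esub> (z \<lhd> b) \<longleftrightarrow> x \<lhd> b = y"
proof -
  have "x \<lhd> b = ((x \<otimes>\<^bsub>G\<^esub> inv\<^bsub>G\<^esub> z) \<lhd> (z \<rhd> b)) \<otimes>\<^bsub>G\<^esub> (z \<lhd> b)"
    using ract_match[of "x \<otimes>\<^bsub>G\<^esub> inv\<^bsub>G\<^esub> z" z b] assms by (simp add: G.m_assoc)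
  then show ?thesis
    using assms by (auto simp: G.m_assoc)
qed

lemma k_bialgebra_bismash: "k_bialgebra (A :: ('g \<times> 'f, 'k::field) bialg)"
proof (intro k_bialgebraI k_algebra_bismash k_coalgebra_bismash)
  have "bcomult A (aone A) =
      (\<Sum>x\<in>carrier G. \<Sum>y\<in>carrier G. bvec ((x \<otimes>\<^bsub>G\<^esub> inv\<^bsub>G\<^esub> y, \<one>\<^bsub>F\<^esub>), (y, \<one>\<^bsub>F\<^esub>)))"
    by (simp add: linext_sum)
  also have "\<dots> = (\<Sum>y\<in>carrier G. \<Sum>x\<in>carrier G. bvec ((x \<otimes>\<^bsub>G\<^esub> inv\<^bsub>G\<^esub> y, \<one>\<^bsub>F\<^esub>), (y, \<one>\<^bsub>F\<^esub>)))"
    by (rule sum.swap)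
  also have "\<dots> = (\<Sum>y\<in>carrier G. \<Sum>x\<in>carrier G. bvec ((x, \<one>\<^bsub>F\<^esub>), (y, \<one>\<^bsub>F\<^esub>)))"
    by (intro sum.cong refl G.sum_right_translate[where f = "\<lambda>x. bvec ((x, \<one>\<^bsub>F\<^esub>), (_, \<one>\<^bsub>F\<^esub>))"]) simp
  also have "\<dots> = aone A \<otimes>\<^sub>k aone A"
    by (simp add: tensor_sum)
  finally show "bcomult A (aone A) = aone A \<otimes>\<^sub>k aone A" .
next
  show "bcounit A (aone A) = 1"
    unfolding bismash_simps eform_of_sum[OF eform_weighted_sum_plain] by simp
next
  fix p q assume "p \<in> abasis A" "q \<in> abasis A"
  then obtain x b y c where pq: "p = (x, b)" "q = (y, c)"
    and in_carrier: "x \<in> carrier G" "b \<in> carrier F" "y \<in> carrier G" "c \<in> carrier F"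
    by auto
  show "bcounit A (amult A (bvec p) (bvec q)) = bcounit A (bvec p) * bcounit A (bvec q)"
    using in_carrier by (auto simp: pq)
  let ?s = "\<lambda>z. bvec ((x \<otimes>\<^bsub>G\<^esub> inv\<^bsub>G\<^esub> z, z \<rhd> (b \<otimes>\<^bsub>F\<^esub> c)), (z, b \<otimes>\<^bsub>F\<^esub> c)) :: ('g \<times> 'f) \<times> ('g \<times> 'f) \<Rightarrow> 'k"
  let ?A = "A :: ('g \<times> 'f, 'k) bialg"
  have "amult (tensor_alg ?A ?A) (bcomult A (bvec p)) (bcomult A (bvec q)) =
      (\<Sum>w\<in>carrier G. \<Sum>z\<in>carrier G. if z \<lhd> b = w then
        (if (x \<otimes>\<^bsub>G\<^esub> inv\<^bsub>G\<^esub> z) \<lhd> (z \<rhd> b) = y \<otimes>\<^bsub>G\<^esub> inv\<^bsub>G\<^esub> w then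
          bvec (x \<otimes>\<^bsub>G\<^esub> inv\<^bsub>G\<^esub> z, (z \<rhd> b) \<otimes>\<^bsub>F\<^esub> (w \<rhd> c)) else 0) \<otimes>\<^sub>k bvec (z, b \<otimes>\<^bsub>F\<^esub> c) else 0)"
    using in_carrier by (simp add: pq tensor_alg_sum tensor_if)
  also have "\<dots> = (\<Sum>z\<in>carrier G. \<Sum>w\<in>carrier G. if z \<lhd> b = w then
        (if (x \<otimes>\<^bsub>G\<^esub> inv\<^bsub>G\<^esub> z) \<lhd> (z \<rhd> b) = y \<otimes>\<^bsub>G\<^esub> inv\<^bsub>G\<^esub> w then
          bvec (x \<otimes>\<^bsub>G\<^esub> inv\<^bsub>G\<^esub> z, (z \<rhd> b) \<otimes>\<^bsub>F\<^esub> (w \<rhd> c)) else 0) \<otimes>\<^sub>k bvec (z, b \<otimes>\<^bsub>F\<^esub> c) else 0)"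
    by (rule sum.swap)
  also have "\<dots> = (\<Sum>z\<in>carrier G. if x \<lhd> b = y then ?s z else 0)"
    using in_carrier
    by (cases "x \<lhd> b = y") (auto simp: split_product_condition lact_match intro!: sum.cong)
  also have "\<dots> = bcomult A (amult A (bvec p) (bvec q))"
    using in_carrier by (simp add: pq)
  finally show "bcomult ?A (amult ?A (bvec p) (bvec q)) =
      amult (tensor_alg ?A ?A) (bcomult ?A (bvec p)) (bcomult ?A (bvec q))"
    by (rule sym)
qed (auto simp: ebilinear_bilext intro!: vspace_sum)

text \<open>
  By \<open>inv_ract\<close>, \<open>(x \<lhd> b)\<inverse> = x\<inverse> \<lhd> (x \<rhd> b)\<close>, and the action of \<open>x \<rhd> b\<close> cancels.
\<close>

lemma inv_ract_ract_inv_lact: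
  assumes "x \<in> carrier G" "b \<in> carrier F"
  shows "inv\<^bsub>G\<^esub> (x \<lhd> b) \<lhd> inv\<^bsub>F\<^esub> (x \<rhd> b) = inv\<^bsub>G\<^esub> x"
  using assms by (simp add: inv_ract flip: ract_mult)

lemma sum_ract_translate:
  assumes "b \<in> carrier F"
  shows "(\<Sum>y\<in>carrier G. f (y \<lhd> b)) = (\<Sum>y\<in>carrier G. f y)"
  using assms
  by (intro sum.reindex_bij_witness[of _ "\<lambda>y. y \<lhd> inv\<^bsub>F\<^esub> b" "\<lambda>y. y \<lhd> b"])
     (auto simp flip: ract_mult)

lemma sum_inv: "(\<Sum>y\<in>carrier G. f (inv\<^bsub>G\<^esub> y)) = (\<Sum>y\<in>carrier G. f y)"
  by (intro sum.reindex_bij_witness[of _ "\<lambda>y. inv\<^bsub>G\<^esub> y" "\<lambda>y. inv\<^bsub>G\<^esub> y"]) auto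

text \<open>
  Both convolution products turn into a sum over \<open>y\<close> whose terms vanish unless \<open>x = 1\<close> and are then
  \<open>p\<^bsub>y \<lhd> b\<^esub> # 1\<close> and \<open>p\<^bsub>y\<inverse>\<^esub> # 1\<close>.  Since \<open>y \<mapsto> y \<lhd> b\<close> and inversion are bijections of \<open>G\<close>, these sum to the
  unit.
\<close>

lemma conv_inverse_bismash:
  "conv_inverse (coalg_of A) (A :: ('g \<times> 'f, 'k::field) bialg)
    (linext (carrier G \<times> carrier F) (\<lambda>(x, b). bvec (inv\<^bsub>G\<^esub> (x \<lhd> b), inv\<^bsub>F\<^esub> (x \<rhd> b)))) (\<lambda>h. h)"
proof (intro conv_inverseI)
  fix p assume "p \<in> cbasis (coalg_of (A :: ('g \<times> 'f, 'k::field) bialg))"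
  then obtain x b where p: "p = (x, b)" and x: "x \<in> carrier G" and b: "b \<in> carrier F"
    by auto
  let ?X = "carrier G \<times> carrier F" and ?A = "A :: ('g \<times> 'f, 'k) bialg"
  let ?S = "linext ?X (\<lambda>(x, b). bvec (inv\<^bsub>G\<^esub> (x \<lhd> b), inv\<^bsub>F\<^esub> (x \<rhd> b))) :: ('g \<times> 'f \<Rightarrow> 'k) \<Rightarrow> _"
  have left: "amult ?A
        (bvec (inv\<^bsub>G\<^esub> ((x \<otimes>\<^bsub>G\<^esub> inv\<^bsub>G\<^esub> y) \<lhd> (y \<rhd> b)), inv\<^bsub>F\<^esub> ((x \<otimes>\<^bsub>G\<^esub> inv\<^bsub>G\<^esub> y) \<rhd> y \<rhd> b))) (bvec (y, b)) =
      (if x = \<one>\<^bsub>G\<^esub> then bvec (y \<lhd> b, \<one>\<^bsub>F\<^esub>) else 0)" if y: "y \<in> carrier G" for y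
  proof -
    have "y \<otimes>\<^bsub>G\<^esub> inv\<^bsub>G\<^esub> x = y \<longleftrightarrow> x = \<one>\<^bsub>G\<^esub>"
      using x y by (simp add: G.l_cancel_one G.inv_eq_1_iff)
    moreover have "inv\<^bsub>G\<^esub> (inv\<^bsub>G\<^esub> y \<lhd> (y \<rhd> b)) = y \<lhd> b" "inv\<^bsub>G\<^esub> y \<rhd> y \<rhd> b = b"
      using y b by (simp_all flip: inv_ract lact_mult)
    ultimately show ?thesis
      using x y b by (auto simp: inv_ract_ract_inv_lact G.inv_mult_group)
  qed
  have right: "amult ?A (bvec (x \<otimes>\<^bsub>G\<^esub> inv\<^bsub>G\<^esub> y, y \<rhd> b))
        (bvec (inv\<^bsub>G\<^esub> (y \<lhd> b), inv\<^bsub>F\<^esub> (y \<rhd> b))) =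
      (if x = \<one>\<^bsub>G\<^esub> then bvec (inv\<^bsub>G\<^esub> y, \<one>\<^bsub>F\<^esub>) else 0)" if y: "y \<in> carrier G" for y
    using x y b split_product_condition[of x "\<one>\<^bsub>G\<^esub>" y b] ract_eq_iff[of x "\<one>\<^bsub>G\<^esub>" b] by auto
  have "sweedler ?X ?X (bcomult A (bvec p)) (\<lambda>x1 x2. amult ?A (?S x1) x2) =
      (\<Sum>y\<in>carrier G. if x = \<one>\<^bsub>G\<^esub> then bvec (y \<lhd> b, \<one>\<^bsub>F\<^esub>) else 0)"
    using x b by (simp add: p sweedler_sum left del: bismash_simps(2))
  also have "\<dots> = bcounit A (bvec p) \<cdot> aone A"
    using x b sum_ract_translate[of b "\<lambda>y. bvec (y, \<one>\<^bsub>F\<^esub>) :: _ \<Rightarrow> 'k"] by (simp add: p)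
  finally show "sweedler (cbasis (coalg_of ?A)) (cbasis (coalg_of ?A)) (ccomult (coalg_of A) (bvec p))
      (\<lambda>x1 x2. amult ?A (?S x1) x2) = ccounit (coalg_of A) (bvec p) \<cdot> aone A"
    by simp
  have "sweedler ?X ?X (bcomult A (bvec p)) (\<lambda>x1 x2. amult ?A x1 (?S x2)) =
      (\<Sum>y\<in>carrier G. if x = \<one>\<^bsub>G\<^esub> then bvec (inv\<^bsub>G\<^esub> y, \<one>\<^bsub>F\<^esub>) else 0)"
    using x b by (simp add: p sweedler_sum right del: bismash_simps(2))
  also have "\<dots> = bcounit A (bvec p) \<cdot> aone A"
    using x b sum_inv[of "\<lambda>y. bvec (y, \<one>\<^bsub>F\<^esub>) :: _ \<Rightarrow> 'k"] by (simp add: p)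
  finally show "sweedler (cbasis (coalg_of ?A)) (cbasis (coalg_of ?A)) (ccomult (coalg_of A) (bvec p))
      (\<lambda>x1 x2. amult ?A x1 (?S x2)) = ccounit (coalg_of A) (bvec p) \<cdot> aone A"
    by simp
qed (auto simp: elinear_id)

lemma hopf_algebra_bismash: "hopf_algebra A"
  using k_bialgebra_bismash conv_inverse_bismash by (auto simp: hopf_algebra_def)

end

section \<open>The mapping system is partially admissible\<close>

lemma comod_F_simps [simp]:
  "abasis (comod_F F G) = carrier F"
  "amult (comod_F F G) = amult (group_bialg F)"
  "aone (comod_F F G) = bvec \<one>\<^bsub>F\<^esub>"
  "coact (comod_F F G) = linext (carrier F) (\<lambda>b. bvec ((b, \<one>\<^bsub>G\<^esub>), b))"
  by (simp_all add: comod_F_def del: group_bialg_simps(2))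

lemma mod_G_simps [simp]:
  "cbasis (mod_G F G ract) = carrier G"
  "ccomult (mod_G F G ract) = linext (carrier G) (\<lambda>x. bvec (x, x))"
  "ccounit (mod_G F G ract) = (\<lambda>v. \<Sum>x\<in>carrier G. v x)"
  "act (mod_G F G ract) = bilext (carrier G) (carrier F \<times> carrier G)
    (\<lambda>x (b, y). bvec (ract x b \<otimes>\<^bsub>G\<^esub> y))"
  by (simp_all add: mod_G_def)

lemma k_coalgebra_mod_G: "finite (carrier G) \<Longrightarrow> k_coalgebra (mod_G F G ract)"
  using k_coalgebra_group[of G] by (simp add: k_coalgebra_def)

lemma k_algebra_comod_F: "group F \<Longrightarrow> finite (carrier F) \<Longrightarrow> k_algebra (comod_F F G)"
  using k_algebra_group[of F] by (simp add: k_algebra_def)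

context finite_matched_pair
begin

abbreviation H where "H \<equiv> group_bialg K"
abbreviation B where "B \<equiv> comod_F F G"
abbreviation C where "C \<equiv> mod_G F G (\<lhd>)"

lemmas system_defs = iota_F_def iota_G_def pi_F_def pi_G_def

lemma hopf_algebra_H: "hopf_algebra H"
  by (intro hopf_algebra_group group_bowtie) simp

lemma left_comodule_algebra_B:
  "left_comodule_algebra H (B :: ('f \<times> 'g, 'f, 'k::field) comod_alg)"
  unfolding left_comodule_algebra_def Let_def
proof (intro conjI ballI k_algebra_comod_F)
  let ?B = "B :: ('f \<times> 'g, 'f, 'k) comod_alg"
  show "algebra_map ?B (tensor_alg H ?B) (coact ?B)"
    by (rule algebra_mapI)
       (auto simp: ebilinear_bilext ebilinear_tensor_alg, auto simp: tensor_alg_def)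
qed (simp_all, (rule elinear_eqI[OF finF]; (auto intro!: elinear_intros)[1])+)

lemma comodule_algebra_map_iota: "comodule_algebra_map_into H B (iota_F F G)"
  unfolding comodule_algebra_map_into_def
proof (intro conjI ballI)
  show "algebra_map B H (iota_F F G)"
    by (rule algebra_mapI) (auto simp: ebilinear_bilext system_defs)
qed (rule elinear_eqI[OF finF]; (auto intro!: elinear_intros simp: system_defs)[1])

lemma right_module_coalgebra_C:
  "right_module_coalgebra H (C :: ('f \<times> 'g, 'g, 'k::field) mod_coalg)"
  unfolding right_module_coalgebra_def Let_def
proof (intro conjI ballI k_coalgebra_mod_G finG)
  let ?H = "H :: ('f \<times> 'g, 'k) bialg" and ?C = "C :: ('f \<times> 'g, 'g, 'k) mod_coalg"
  have finH: "finite (carrier F \<times> carrier G)"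
    by simp
  show "kbilinear (cbasis ?C) (abasis ?H) (cbasis ?C) (act ?C)"
    by (rule kbilinearI) (auto intro!: elinear_intros)
  fix x :: "'g \<Rightarrow> 'k" and h h' :: "'f \<times> 'g \<Rightarrow> 'k"
  assume "x \<in> vspace (cbasis ?C)"
  then have x: "x \<in> vspace (carrier G)"
    by simp
  show "act ?C x (aone ?H) = x"
    by (rule elinear_eqI[OF finG x]) (auto intro!: elinear_intros)
  assume "h \<in> vspace (abasis ?H)"
  then have h: "h \<in> vspace (carrier F \<times> carrier G)"
    by simp
  show "ccounit ?C (act ?C x h) = ccounit ?C x * bcounit ?H h"
    by (rule eform_eqI2[OF finG finH x h])
       (auto intro!: elinear_intros eform_comp[OF eform_sum] eform_mult eform_sum)
  show "ccomult ?C (act ?C x h) =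
      sweedler (cbasis ?C) (cbasis ?C) (ccomult ?C x) (\<lambda>x1 x2.
        sweedler (abasis ?H) (abasis ?H) (bcomult ?H h) (\<lambda>h1 h2. act ?C x1 h1 \<otimes>\<^sub>k act ?C x2 h2))"
    by (rule elinear_eqI2[OF finG finH x h]) (auto intro!: elinear_intros)
  assume "h' \<in> vspace (abasis ?H)"
  then have h': "h' \<in> vspace (carrier F \<times> carrier G)"
    by simp
  show "act ?C x (amult ?H h h') = act ?C (act ?C x h) h'"
  proof (rule elinear_eqI[OF finG x])
    fix y assume y: "y \<in> carrier G"
    show "act ?C (bvec y) (amult ?H h h') = act ?C (act ?C (bvec y) h) h'"
      by (rule elinear_eqI2[OF finH finH h h'])
         (use y in \<open>auto intro!: elinear_intros simp: ract_match ract_mult G.m_assoc\<close>)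
  qed (auto intro!: elinear_intros)
qed

lemma module_coalgebra_map_pi:
  "module_coalgebra_map_from H C (pi_G F G :: ('f \<times> 'g \<Rightarrow> 'k::field) \<Rightarrow> _)"
  unfolding module_coalgebra_map_from_def
proof (intro conjI ballI)
  let ?H = "H :: ('f \<times> 'g, 'k) bialg" and ?C = "C :: ('f \<times> 'g, 'g, 'k) mod_coalg"
  show "coalgebra_map (coalg_of ?H) ?C (pi_G F G)"
    by (rule coalgebra_mapI) (auto simp: eform_sum system_defs)
  have finH: "finite (carrier F \<times> carrier G)"
    by simp
  fix h h' :: "'f \<times> 'g \<Rightarrow> 'k"
  assume "h \<in> vspace (abasis ?H)" "h' \<in> vspace (abasis ?H)"
  then have hh': "h \<in> vspace (carrier F \<times> carrier G)" "h' \<in> vspace (carrier F \<times> carrier G)"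
    by simp_all
  show "pi_G F G (amult ?H h h') = act ?C (pi_G F G h) h'"
    by (rule elinear_eqI2[OF finH finH hh']) (auto intro!: elinear_intros simp: system_defs)
qed

lemma pi_F_iota_F: "b \<in> vspace (carrier F) \<Longrightarrow> pi_F F G (iota_F F G b) = b"
  by (rule elinear_eqI[OF finF]) (auto intro!: elinear_intros simp: system_defs)

lemma pi_G_iota_G: "x \<in> vspace (carrier G) \<Longrightarrow> pi_G F G (iota_G F G x) = x"
  by (rule elinear_eqI[OF finG]) (auto intro!: elinear_intros simp: system_defs)

lemma inj_on_iota_F: "inj_on (iota_F F G) (vspace (carrier F))"
  by (rule inj_on_inverseI, rule pi_F_iota_F)

lemma klinear_system:
  "klinear (carrier F) (carrier F \<times> carrier G) (iota_F F G)"
  "klinear (carrier G) (carrier F \<times> carrier G) (iota_G F G)"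
  "klinear (carrier F \<times> carrier G) (carrier F) (pi_F F G)"
  "klinear (carrier F \<times> carrier G) (carrier G) (pi_G F G)"
  by (rule klinearI; auto simp: system_defs)+

lemma surj_pi_G:
  "pi_G F G ` vspace (carrier F \<times> carrier G) = (vspace (carrier G) :: ('g \<Rightarrow> 'k::field) set)"
proof
  show "(vspace (carrier G) :: ('g \<Rightarrow> 'k) set) \<subseteq> pi_G F G ` vspace (carrier F \<times> carrier G)"
  proof
    fix x :: "'g \<Rightarrow> 'k" assume x: "x \<in> vspace (carrier G)"
    then have "iota_G F G x \<in> vspace (carrier F \<times> carrier G)"
      by (rule vspace_elinear[OF finG, where T = "iota_G F G"]) (auto simp: system_defs)
    then show "x \<in> pi_G F G ` vspace (carrier F \<times> carrier G)"
      using pi_G_iota_G[OF x] by (metis image_eqI)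
  qed
qed (use klinear_system(4) in \<open>auto simp: klinear_def\<close>)

lemma conv_invertible_pi_F: "conv_invertible (coalg_of H) B (pi_F F G)"
proof -
  have "conv_inverse (coalg_of H) (group_bialg F) (linext (carrier K) (\<lambda>p. bvec (inv\<^bsub>F\<^esub> fst p)))
      (pi_F F G)"
    using conv_inverse_grouplike[of F K fst]
    by (auto simp: pi_F_def case_prod_unfold F.group_axioms)
  then have "conv_inverse (coalg_of H) B (linext (carrier K) (\<lambda>p. bvec (inv\<^bsub>F\<^esub> fst p))) (pi_F F G)"
    by (simp add: conv_inverse_def)
  then show ?thesis
    unfolding conv_invertible_def by blast
qed

lemma conv_invertible_iota_G: "conv_invertible C H (iota_G F G)"
proof -
  have "conv_inverse (coalg_of (group_bialg G)) H
      (linext (carrier G) (\<lambda>x. bvec (inv\<^bsub>K\<^esub> (\<one>\<^bsub>F\<^esub>, x)))) (iota_G F G)"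
    using conv_inverse_grouplike[OF group_bowtie, of G "\<lambda>x. (\<one>\<^bsub>F\<^esub>, x)"]
    by (auto simp: iota_G_def)
  then have "conv_inverse C H (linext (carrier G) (\<lambda>x. bvec (inv\<^bsub>K\<^esub> (\<one>\<^bsub>F\<^esub>, x)))) (iota_G F G)"
    by (simp add: conv_inverse_def)
  then show ?thesis
    unfolding conv_invertible_def by blast
qed

text \<open>
  The coaction \<open>\<Sum> h\<^sub>1 \<otimes> \<pi>(h\<^sub>2)\<close> sends the basis vector \<open>(b, x)\<close> to \<open>(b, x) \<otimes> x\<close>.  So the coefficient of \<open>(b, x) \<otimes> x\<close> in
  \<open>\<Sum> h\<^sub>1 \<otimes> \<pi>(h\<^sub>2)\<close> is that of \<open>(b, x)\<close> in \<open>h\<close>, whereas in \<open>h \<otimes> 1\<close> it is \<open>0\<close> for \<open>x \<noteq> 1\<close>.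
\<close>

lemma coinvariants:
  "iota_F F G ` vspace (carrier F) =
    {h \<in> vspace (carrier F \<times> carrier G).
      sweedler (carrier F \<times> carrier G) (carrier F \<times> carrier G) (bcomult H h)
        (\<lambda>h1 h2. h1 \<otimes>\<^sub>k pi_G F G h2) = h \<otimes>\<^sub>k (bvec \<one>\<^bsub>G\<^esub> :: 'g \<Rightarrow> 'k::field)}"
    (is "_ = {h \<in> _. ?\<rho> h = _}")
proof (intro Set.equalityI subsetI)
  let ?X = "carrier F \<times> carrier G"
  fix h :: "'f \<times> 'g \<Rightarrow> 'k" assume "h \<in> iota_F F G ` vspace (carrier F)"
  then obtain b where b: "b \<in> vspace (carrier F)" and h: "h = iota_F F G b"
    by auto
  have "?\<rho> (iota_F F G b) = iota_F F G b \<otimes>\<^sub>k bvec \<one>\<^bsub>G\<^esub>"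
    by (rule elinear_eqI[OF finF b]) (auto intro!: elinear_intros simp: system_defs)
  then show "h \<in> {h \<in> vspace ?X. ?\<rho> h = h \<otimes>\<^sub>k bvec \<one>\<^bsub>G\<^esub>}"
    using b h klinear_system(1) by (auto simp: klinear_def)
next
  let ?X = "carrier F \<times> carrier G"
  fix h :: "'f \<times> 'g \<Rightarrow> 'k" assume "h \<in> {h \<in> vspace ?X. ?\<rho> h = h \<otimes>\<^sub>k bvec \<one>\<^bsub>G\<^esub>}"
  then have h: "h \<in> vspace ?X" and coinv: "?\<rho> h = h \<otimes>\<^sub>k bvec \<one>\<^bsub>G\<^esub>"
    by auto
  have finX: "finite ?X"
    by simp
  have "?\<rho> h = (\<Sum>p\<in>?X. h p \<cdot> ?\<rho> (bvec p))"
    by (intro elinear_expand finX h elinear_intros) auto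
  also have "\<dots> = (\<Sum>p\<in>?X. h p \<cdot> bvec (p, snd p))"
    by (intro sum.cong refl) (auto simp: system_defs)
  finally have \<rho>: "?\<rho> h = (\<Sum>p\<in>?X. h p \<cdot> bvec (p, snd p))" .
  have "h q = 0" if "q \<in> ?X" "snd q \<noteq> \<one>\<^bsub>G\<^esub>" for q
  proof -
    have "h q = (\<Sum>p\<in>?X. h p * (if q = p then 1 else 0))"
      using that by (simp add: if_distrib[of "\<lambda>c. _ * c"] cong: if_cong)
    also have "\<dots> = (\<Sum>p\<in>?X. h p * bvec (p, snd p) (q, snd q))"
      by (intro sum.cong refl) (auto simp: bvec_def)
    also have "\<dots> = ?\<rho> h (q, snd q)"
      unfolding \<rho> by (simp add: sum_fun_apply scal_def)
    also have "\<dots> = 0"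
      unfolding coinv using that by (simp add: tensor_def bvec_def)
    finally show ?thesis .
  qed
  then have "(\<Sum>p\<in>?X. h p \<cdot> bvec p) = (\<Sum>p\<in>?X. h p \<cdot> bvec (fst p, \<one>\<^bsub>G\<^esub>))"
    by (intro sum.cong refl) (force simp: prod_eq_iff)
  also have "\<dots> = (\<Sum>p\<in>?X. h p \<cdot> iota_F F G (pi_F F G (bvec p)))"
    by (intro sum.cong refl) (auto simp: system_defs)
  also have "\<dots> = iota_F F G (pi_F F G h)"
    by (intro elinear_expand[symmetric] finX h) (auto intro!: elinear_intros simp: system_defs)
  finally have "h = iota_F F G (pi_F F G h)"
    using vspace_expand[OF finX h] by simp
  then show "h \<in> iota_F F G ` vspace (carrier F)"
    using h klinear_system(3) by (auto simp: klinear_def)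
qed

lemma partially_admissible:
  "partially_admissible_system H B C (iota_F F G) (pi_G F G) (pi_F F G)
    (iota_G F G :: ('g \<Rightarrow> 'k::field) \<Rightarrow> _)"
proof -
  let ?H = "H :: ('f \<times> 'g, 'k) bialg" and ?B = "B :: ('f \<times> 'g, 'f, 'k) comod_alg"
    and ?C = "C :: ('f \<times> 'g, 'g, 'k) mod_coalg"
  have finH: "finite (carrier F \<times> carrier G)"
    by simp
  have "pi_F F G (amult ?H (iota_F F G b) h) = amult ?B b (pi_F F G h)"
    if "b \<in> vspace (carrier F)" "h \<in> vspace (carrier F \<times> carrier G)" for b h
    by (rule elinear_eqI2[OF finF finH that]) (auto intro!: elinear_intros simp: system_defs)
  moreover have "sweedler (abasis ?H) (abasis ?H) (bcomult ?H (iota_G F G x))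
      (\<lambda>y1 y2. y1 \<otimes>\<^sub>k pi_G F G y2) =
    sweedler (cbasis ?C) (cbasis ?C) (ccomult ?C x) (\<lambda>x1 x2. iota_G F G x1 \<otimes>\<^sub>k x2)"
    if "x \<in> vspace (carrier G)" for x
    by (rule elinear_eqI[OF finG that]) (auto intro!: elinear_intros simp: system_defs)
  moreover have "bcounit ?H (iota_F F G (pi_F F G h)) = bcounit ?H h"
    if "h \<in> vspace (carrier F \<times> carrier G)" for h
    by (rule eform_eqI[OF finH that])
       (auto intro!: elinear_intros eform_comp[OF eform_sum] eform_sum simp: system_defs)
  moreover have "bcounit ?H (iota_G F G x) = ccounit ?C x" if "x \<in> vspace (carrier G)" for x
    by (rule eform_eqI[OF finG that])
       (auto intro!: elinear_intros eform_comp[OF eform_sum] eform_sum simp: system_defs)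
  moreover have "sweedler (abasis ?H) (abasis ?H) (bcomult ?H h)
      (\<lambda>h1 h2. amult ?H (iota_F F G (pi_F F G h1)) (iota_G F G (pi_G F G h2))) = h"
    if "h \<in> vspace (carrier F \<times> carrier G)" for h
    by (rule elinear_eqI[OF finH that]) (auto intro!: elinear_intros simp: system_defs)
  moreover have "pi_F F G (aone ?H) = aone ?B" "pi_G F G (aone ?H) = bvec \<one>\<^bsub>G\<^esub>"
    "iota_G F G (pi_G F G (aone ?H)) = aone ?H"
    by (simp_all add: system_defs)
  ultimately show ?thesis
    unfolding partially_admissible_system_def Let_def
    using hopf_algebra_H left_comodule_algebra_B comodule_algebra_map_iota inj_on_iota_F
      right_module_coalgebra_C module_coalgebra_map_pi surj_pi_G coinvariants klinear_system
      conv_invertible_pi_F conv_invertible_iota_G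
    by (simp del: group_bialg_simps(2-5) comod_F_simps(2-4) mod_G_simps(2-4))
qed

end

section \<open>The left partial dual is the bismash product\<close>

context finite_matched_pair
begin

abbreviation D where "D \<equiv> left_partial_dual H B C (iota_F F G) (pi_G F G) (pi_F F G) (iota_G F G)"

lemma mult_dual_C [simp]:
  "x \<in> carrier G \<Longrightarrow> y \<in> carrier G \<Longrightarrow>
    amult (dual_alg C) (bvec x) (bvec y) = (if x = y then bvec x else 0)"
  by (auto simp: amult_dual_alg bvec_def fun_eq_iff)

lemma one_dual_C: "aone (dual_alg C) = (\<Sum>x\<in>carrier G. bvec x)"
  by (auto simp: dual_alg_def fun_eq_iff sum_fun_apply) (auto simp: bvec_def)

lemma ract_shift_iff:
  assumes "x \<in> carrier G" "z \<in> carrier G" "b \<in> carrier F" "w \<in> carrier G"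
  shows "(x \<lhd> b) \<otimes>\<^bsub>G\<^esub> w = z \<longleftrightarrow> x = (z \<otimes>\<^bsub>G\<^esub> inv\<^bsub>G\<^esub> w) \<lhd> inv\<^bsub>F\<^esub> b"
proof -
  have "(x \<lhd> b) \<otimes>\<^bsub>G\<^esub> w = z \<longleftrightarrow> x \<lhd> b = z \<otimes>\<^bsub>G\<^esub> inv\<^bsub>G\<^esub> w"
    using assms by (auto simp: G.m_assoc)
  then show ?thesis
    using assms by (simp add: ract_eq_iff)
qed

text \<open>
  For given \<open>b\<close> and \<open>w\<close> the equation \<open>(x \<lhd> b) w = z\<close> has exactly one solution \<open>x\<close>.  Writing the dual
  coaction as a sum of basis vectors makes Sweedler sums over it computable.
\<close>

lemma dual_coact_bvec:
  assumes "z \<in> carrier G"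
  shows "dual_coact H C (bvec z) = (
    (\<Sum>b\<in>carrier F. \<Sum>w\<in>carrier G. bvec ((z \<otimes>\<^bsub>G\<^esub> inv\<^bsub>G\<^esub> w) \<lhd> inv\<^bsub>F\<^esub> b, (b, w))) :: _ \<Rightarrow> 'k::field)"
proof (rule ext)
  fix t :: "'g \<times> 'f \<times> 'g"
  obtain x c y where t: "t = (x, c, y)"
    by (cases t)
  have "(\<Sum>b\<in>carrier F. \<Sum>w\<in>carrier G. bvec ((z \<otimes>\<^bsub>G\<^esub> inv\<^bsub>G\<^esub> w) \<lhd> inv\<^bsub>F\<^esub> b, (b, w)) t :: 'k) =
    (\<Sum>b\<in>carrier F. \<Sum>w\<in>carrier G. if y = w then
      (if c = b then (if x = (z \<otimes>\<^bsub>G\<^esub> inv\<^bsub>G\<^esub> w) \<lhd> inv\<^bsub>F\<^esub> b then 1 else 0) else 0) else 0)"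
    by (intro sum.cong refl) (auto simp: t bvec_def)
  also have "\<dots> = (if x \<in> carrier G \<and> c \<in> carrier F \<and> y \<in> carrier G \<and> (x \<lhd> c) \<otimes>\<^bsub>G\<^esub> y = z then 1 else 0)"
    using assms by (cases "y \<in> carrier G") (auto simp: ract_shift_iff)
  also have "\<dots> = dual_coact H C (bvec z :: _ \<Rightarrow> 'k) t"
    by (auto simp: t dual_coact_def) (auto simp: bvec_apply)
  finally show "dual_coact H C (bvec z :: _ \<Rightarrow> 'k) t =
    (\<Sum>b\<in>carrier F. \<Sum>w\<in>carrier G. bvec ((z \<otimes>\<^bsub>G\<^esub> inv\<^bsub>G\<^esub> w) \<lhd> inv\<^bsub>F\<^esub> b, (b, w))) t"
    by (simp add: sum_fun_apply)
qed

abbreviation zeta_t where "zeta_t \<equiv> transposed (carrier F \<times> carrier G) (carrier F) (pi_F F G)"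
abbreviation gamma_t where "gamma_t \<equiv> transposed (carrier G) (carrier F \<times> carrier G) (iota_G F G)"

lemma pi_F_bvec [simp]: "b \<in> carrier F \<Longrightarrow> x \<in> carrier G \<Longrightarrow> pi_F F G (bvec (b, x)) = bvec b"
  and iota_G_bvec [simp]: "x \<in> carrier G \<Longrightarrow> iota_G F G (bvec x) = bvec (\<one>\<^bsub>F\<^esub>, x)"
  by (simp_all add: system_defs)

lemma transposed_iota_G_bvec:
  "b \<in> carrier F \<Longrightarrow> x \<in> carrier G \<Longrightarrow>
    gamma_t (bvec (b, x)) = (if b = \<one>\<^bsub>F\<^esub> then bvec x else 0)"
  by (auto simp: transposed_def fun_eq_iff bvec_apply)

text \<open>
  The functional \<open>\<zeta>\<^sup>*(c\<^sup>*)\<close> is the indicator function of \<open>{c} \<times> G\<close>.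
\<close>

lemma mult_dual_H_transposed_pi_F:
  "b \<in> carrier F \<Longrightarrow> x \<in> carrier G \<Longrightarrow>
    amult (dual_alg (coalg_of H)) (bvec (b, x)) (zeta_t (bvec c)) =
    (if b = c then bvec (b, x) else 0)"
  by (auto simp: amult_dual_alg transposed_def fun_eq_iff bvec_apply)

lemma dual_comult_transposed_pi_F:
  "dual_comult H (zeta_t (bvec c)) ((b, x), (b', y)) =
    (if b \<in> carrier F \<and> x \<in> carrier G \<and> b' \<in> carrier F \<and> y \<in> carrier G \<and> b \<otimes>\<^bsub>F\<^esub> (x \<rhd> b') = c
     then 1 else 0)"
  by (auto simp: dual_comult_def transposed_def system_defs) (auto simp: bvec_def)

lemma abasis_D: "abasis D = carrier G \<times> carrier F"
  by (simp add: left_partial_dual_def Let_def)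

lemma aone_D: "aone D = aone A"
  by (simp add: left_partial_dual_def Let_def one_dual_C tensor_sum)

lemma bcounit_D: "bcounit D = bcounit A"
  by (auto simp: left_partial_dual_def Let_def system_defs fun_eq_iff case_prod_unfold
      intro!: sum.cong) (auto simp: bvec_def)

text \<open>
  The value of \<open>\<gamma>\<^sup>*[(b, x)\<^sup>* \<zeta>\<^sup>*(c\<^sup>*)]\<close> at \<open>y\<close> is \<open>(b, x)\<^sup>*(1, y) \<cdot> c\<^sup>*(1)\<close>.  In the
  coproduct it fixes the index of the dual basis of \<open>kF\<close>, in the associator that of the second one.
\<close>

lemma transposed_composite [simp]:
  "b \<in> carrier F \<Longrightarrow> x \<in> carrier G \<Longrightarrow> gamma_t (amult (dual_alg (coalg_of H)) (bvec (b, x)) (zeta_t (bvec c))) =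
    (if b = \<one>\<^bsub>F\<^esub> \<and> c = \<one>\<^bsub>F\<^esub> then bvec x else 0)"
  by (auto simp: mult_dual_H_transposed_pi_F transposed_iota_G_bvec)
    (auto simp: transposed_def fun_eq_iff pairing_def)

lemma mult_dual_C_0 [simp]: "amult (dual_alg C) 0 f = 0"
  by (simp add: amult_dual_alg fun_eq_iff)

text \<open>
  Pairing with \<open>(b, 1)\<close> leaves the single term \<open>p\<^sub>x p\<^bsub>y \<lhd> b\<inverse>\<^esub>\<close> of the dual coaction.
\<close>

lemma amult_D_bvec:
  assumes "x \<in> carrier G" "b \<in> carrier F" "y \<in> carrier G" "c \<in> carrier F"
  shows "sweedler (carrier G) (carrier F \<times> carrier G) (dual_coact H C (bvec y)) (\<lambda>g1 g2.
      sweedler (carrier F \<times> carrier G) (carrier F) (coact B (bvec b)) (\<lambda>b1 b2.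
        amult (dual_alg C) (bvec x) g1 \<otimes>\<^sub>k (pairing (carrier F \<times> carrier G) g2 b1 \<cdot> amult B b2 (bvec c)))) =
    (if x \<lhd> b = y then bvec (x, b \<otimes>\<^bsub>F\<^esub> c) else (0 :: _ \<Rightarrow> 'k::field))" (is "?l = ?r")
proof -
  have "?l = (\<Sum>b'\<in>carrier F. \<Sum>w\<in>carrier G.
      (if x = (y \<otimes>\<^bsub>G\<^esub> inv\<^bsub>G\<^esub> w) \<lhd> inv\<^bsub>F\<^esub> b' then bvec x else 0) \<otimes>\<^sub>k
      (bvec (b', w) (b, \<one>\<^bsub>G\<^esub>) \<cdot> bvec (b \<otimes>\<^bsub>F\<^esub> c)))"
    using assms by (simp add: dual_coact_bvec sweedler_sum)
  also have "\<dots> = (\<Sum>b'\<in>carrier F. \<Sum>w\<in>carrier G. if w = \<one>\<^bsub>G\<^esub> then (if b' = b then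
      (if x = (y \<otimes>\<^bsub>G\<^esub> inv\<^bsub>G\<^esub> w) \<lhd> inv\<^bsub>F\<^esub> b' then bvec (x, b \<otimes>\<^bsub>F\<^esub> c) else 0) else 0) else 0)"
    by (intro sum.cong refl) (auto simp: bvec_apply[of "(_, _)" "(b, \<one>\<^bsub>G\<^esub>)"])
  also have "\<dots> = ?r"
    using assms by (simp add: ract_eq_iff)
  finally show ?thesis .
qed

lemmas basis_simps = mod_G_simps(1) comod_F_simps(1) group_bialg_simps(1) bowtie_simps(1)
  coalg_of_simps(1)

lemma amult_D: "amult D = amult A"
proof (intro ext)
  fix s t p
  show "amult D s t p = amult A s t p"
    unfolding bismash_simps left_partial_dual_def Let_def alg.select_convs basis_simps
    by (rule fun_cong[where x = p], rule sweedler2_eq_bilext) (simp only: prod.case amult_D_bvec)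
qed

text \<open>
  Only \<open>c = i = 1\<close> and \<open>j = w\<close> survive, and \<open>\<zeta>((1, j)(b, 1)) = \<zeta>(j \<rhd> b, j \<lhd> b) = j \<rhd> b\<close>.
\<close>

lemma bcomult_D_bvec:
  assumes x: "x \<in> carrier G" and b: "b \<in> carrier F"
  shows "sweedler (carrier G) (carrier F \<times> carrier G) (dual_coact H C (bvec x)) (\<lambda>f1 f2.
      sweedler (carrier F \<times> carrier G) (carrier F) (coact B (bvec b)) (\<lambda>b1 b2.
        \<Sum>i\<in>carrier F. \<Sum>j\<in>carrier G.
          (f1 \<otimes>\<^sub>k amult B (bvec i) (pi_F F G (amult H (iota_G F G (bvec j)) b1))) \<otimes>\<^sub>k
          (amult (dual_alg C) (gamma_t (amult (dual_alg (coalg_of H)) f2 (zeta_t (bvec i)))) (bvec j) \<otimes>\<^sub>k b2))) =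
    (\<Sum>y\<in>carrier G. bvec ((x \<otimes>\<^bsub>G\<^esub> inv\<^bsub>G\<^esub> y, y \<rhd> b), (y, b)) :: _ \<Rightarrow> 'k::field)" (is "?l = ?r")
proof -
  have "?l = (\<Sum>c\<in>carrier F. \<Sum>w\<in>carrier G. \<Sum>i\<in>carrier F. \<Sum>j\<in>carrier G.
      bvec ((x \<otimes>\<^bsub>G\<^esub> inv\<^bsub>G\<^esub> w) \<lhd> inv\<^bsub>F\<^esub> c, i \<otimes>\<^bsub>F\<^esub> (j \<rhd> b)) \<otimes>\<^sub>k
      (amult (dual_alg C) (if c = \<one>\<^bsub>F\<^esub> \<and> i = \<one>\<^bsub>F\<^esub> then bvec w else 0) (bvec j) \<otimes>\<^sub>k bvec b))"
    using assms by (simp add: dual_coact_bvec sweedler_sum)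
  also have "\<dots> = (\<Sum>c\<in>carrier F. \<Sum>w\<in>carrier G. \<Sum>i\<in>carrier F. \<Sum>j\<in>carrier G.
      if j = w then (if i = \<one>\<^bsub>F\<^esub> then (if c = \<one>\<^bsub>F\<^esub> then
        bvec (((x \<otimes>\<^bsub>G\<^esub> inv\<^bsub>G\<^esub> w) \<lhd> inv\<^bsub>F\<^esub> c, i \<otimes>\<^bsub>F\<^esub> (j \<rhd> b)), (j, b)) else 0) else 0) else 0)"
    by (intro sum.cong refl) auto
  also have "\<dots> = ?r"
    using assms by (simp add: sum_if_const)
  finally show ?thesis .
qed

lemma bcomult_D: "bcomult D = bcomult A"
proof (intro ext)
  fix s p
  show "bcomult D s p = bcomult A s p"
    unfolding bismash_simps left_partial_dual_def Let_def bialg.select_convs basis_simps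
      sweedler_eq_linext[of _ _ s]
    by (rule fun_cong[where x = p], rule linext_cong) (auto simp only: prod.case bcomult_D_bvec mem_Sigma_iff)
qed

text \<open>
  A term indexed by \<open>(b, x)\<close> and \<open>(c, y)\<close> occurs only for \<open>i = b (x \<rhd> c)\<close>, the \<open>F\<close>-component of
  \<open>(b, x)(c, y)\<close>.  The factors
  \<open>\<gamma>\<^sup>*\<close> force \<open>b = c = j = 1\<close>, whence \<open>i = 1 (x \<rhd> 1) = 1\<close> and the sums over \<open>x\<close> and \<open>y\<close> give units.
\<close>

lemma inv_assoc_D:
  "inv_assoc D = aone D \<otimes>\<^sub>k aone D \<otimes>\<^sub>k (aone D :: _ \<Rightarrow> 'k::field)"
proof -
  let ?u = "aone (dual_alg C) :: 'g \<Rightarrow> 'k" and ?X = "carrier F \<times> carrier G"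
  let ?t = "\<lambda>x y. (?u \<otimes>\<^sub>k bvec \<one>\<^bsub>F\<^esub>) \<otimes>\<^sub>k (bvec x \<otimes>\<^sub>k bvec \<one>\<^bsub>F\<^esub>) \<otimes>\<^sub>k (bvec y \<otimes>\<^sub>k bvec \<one>\<^bsub>F\<^esub>)"
  have "inv_assoc D = (\<Sum>i\<in>carrier F. \<Sum>j\<in>carrier F.
      sweedler ?X ?X (dual_comult H (zeta_t (bvec i))) (\<lambda>u1 u2.
        (?u \<otimes>\<^sub>k bvec i) \<otimes>\<^sub>k (gamma_t u1 \<otimes>\<^sub>k bvec j) \<otimes>\<^sub>k
        (gamma_t (amult (dual_alg (coalg_of H)) u2 (zeta_t (bvec j))) \<otimes>\<^sub>k bvec \<one>\<^bsub>F\<^esub>)))"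
    unfolding left_partial_dual_def Let_def quasi_bialg.select_convs basis_simps comod_F_simps(3)
    by (rule refl)
  also have "\<dots> = (\<Sum>i\<in>carrier F. \<Sum>j\<in>carrier F. \<Sum>b\<in>carrier F. \<Sum>x\<in>carrier G. \<Sum>c\<in>carrier F. \<Sum>y\<in>carrier G.
      if c = \<one>\<^bsub>F\<^esub> then (if b = \<one>\<^bsub>F\<^esub> then (if j = \<one>\<^bsub>F\<^esub> then (if i = \<one>\<^bsub>F\<^esub> then ?t x y else 0) else 0) else 0) else 0)"
    unfolding sweedler_def sum.cartesian_product'
    by (intro sum.cong refl) (auto simp: dual_comult_transposed_pi_F transposed_iota_G_bvec)
  also have "\<dots> = (\<Sum>x\<in>carrier G. \<Sum>y\<in>carrier G. ?t x y)"
    by (simp add: sum_if_const)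
  also have "\<dots> = (?u \<otimes>\<^sub>k bvec \<one>\<^bsub>F\<^esub>) \<otimes>\<^sub>k (?u \<otimes>\<^sub>k bvec \<one>\<^bsub>F\<^esub>) \<otimes>\<^sub>k (?u \<otimes>\<^sub>k bvec \<one>\<^bsub>F\<^esub>)"
    using tensor_sum2[of "?u \<otimes>\<^sub>k bvec \<one>\<^bsub>F\<^esub>" "\<lambda>x. bvec x \<otimes>\<^sub>k bvec \<one>\<^bsub>F\<^esub>" "carrier G"
        "\<lambda>x. bvec x \<otimes>\<^sub>k bvec \<one>\<^bsub>F\<^esub>" "carrier G"]
    by (simp only: one_dual_C flip: tensor_sum(1))
  also have "\<dots> = aone D \<otimes>\<^sub>k aone D \<otimes>\<^sub>k aone D"
    by (simp add: left_partial_dual_def Let_def)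
  finally show ?thesis .
qed

lemma admissible: "admissible_system H B C (iota_F F G) (pi_G F G) (pi_F F G) (iota_G F G)"
proof -
  have "k_algebra D"
    using k_algebra_bismash unfolding k_algebra_def abasis_D bismash_simps(1) amult_D aone_D .
  moreover have "ebilinear (amult D)"
    unfolding amult_D by (simp add: ebilinear_bilext)
  ultimately show ?thesis
    unfolding admissible_system_def Let_def
    by (intro conjI partially_admissible is_associator_one inv_assoc_D)
qed

lemma bialgebra_iso_D: "bialgebra_iso A D (\<lambda>v. v)"
  unfolding bialgebra_iso_def
proof (intro conjI)
  show "bij_betw (\<lambda>v. v) (vspace (abasis A)) (vspace (abasis D))"
    by (simp add: abasis_D bij_betw_def inj_on_def)
  show "algebra_map A D (\<lambda>v. v)"
    by (rule algebra_mapI) (auto simp: abasis_D amult_D aone_D elinear_id ebilinear_bilext)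
  show "coalgebra_map (coalg_of A) (coalg_of D) (\<lambda>v. v)"
    by (rule coalgebra_mapI) (auto simp: abasis_D bcomult_D bcounit_D elinear_id sweedler_sum)
qed

end

theorem proposition6p18:
  fixes F :: "('f, 'm) monoid_scheme" and G :: "('g, 'n) monoid_scheme"
    and lact :: "'g \<Rightarrow> 'f \<Rightarrow> 'f" and ract :: "'g \<Rightarrow> 'f \<Rightarrow> 'g"
    and H :: "('f \<times> 'g, 'k::field) bialg"
    and B :: "('f \<times> 'g, 'f, 'k) comod_alg" and C :: "('f \<times> 'g, 'g, 'k) mod_coalg"
  assumes "matched_pair F G lact ract" and "finite (carrier F)" and "finite (carrier G)"
  defines "H \<equiv> group_bialg (bowtie F G lact ract)"
    and "B \<equiv> comod_F F G" and "C \<equiv> mod_G F G ract"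
  shows "admissible_system H B C (iota_F F G) (pi_G F G) (pi_F F G) (iota_G F G) \<and>
    hopf_algebra (bismash F G lact ract :: ('g \<times> 'f, 'k) bialg) \<and>
    bialgebra_iso (bismash F G lact ract)
      (left_partial_dual H B C (iota_F F G) (pi_G F G) (pi_F F G) (iota_G F G)) (\<lambda>v. v)"
proof -
  interpret finite_matched_pair F G lact ract
    using assms(1-3) by (simp add: finite_matched_pair_def finite_matched_pair_axioms_def)
  show ?thesis
    unfolding H_def B_def C_def
    by (intro conjI admissible hopf_algebra_bismash bialgebra_iso_D)
qed

end
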